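(* Let $(T,\mathcal{H})$ be a coherent state (CS-) representation of a Lie group $G$ with cyclic vector $e_0$ and CS-manifold $M\cong G/H$, and let $\Phi:\psi\mapsto f_\psi$, $f_\psi(z)=(e_{\bar z},\psi)$, be the associated map to holomorphic functions. Then $$\Phi\, dT(\mathfrak{g}_{\mathbb{C}})\,\Phi^{-1}\subseteq \mathfrak{D}_1 ,$$ that is, for every $X\in\mathfrak{g}_{\mathbb{C}}$ there exist holomorphic functions $P_X, Q_X^1,\dots,Q_X^n$ on the coordinate domain $\mathcal{V}_0\subset M$ such that for all $\psi\in\mathcal{H}^{\infty}$ $$f_{dT(X)\psi}(z)=\Big(P_X(z)+\sum_{i=1}^{n}Q_X^i(z)\frac{\partial}{\partial z_i}\Big)f_\psi(z),\qquad z\in\mathcal{V}_0 .$$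
   Context: Scalar products are antilinear in the first argument and linear in the second. $G$ is a (real) Lie group with Lie algebra $\mathfrak{g}$, $\mathfrak{g}_{\mathbb{C}}$ its complexification; $T$ is a continuous unitary representation of $G$ on a separable complex Hilbert space $\mathcal{H}$; $\mathcal{H}^\infty$ is the space of smooth vectors; $dT$ is the derived representation of $\mathfrak{g}$ on $\mathcal{H}^\infty$, $dT(X)v=\frac{d}{dt}\big|_{t=0}T(\exp tX)v$, extended complex-linearly to $\mathfrak{g}_{\mathbb{C}}$. For $0\ne e_0\in\mathcal{H}^\infty$ let $H=\{g\in G: T(g)e_0\in\mathbb{C}e_0\}$ and $M\cong G/H$, the $G$-orbit of $[e_0]$ in $\mathbb{P}(\mathcal{H}^\infty)$. $(T,\mathcal{H})$ is a CS-representation if there is a cyclic vector $e_0\in\mathcal{H}^\infty$, $e_0\neq 0$ (taken to be a unit vector), such that $M$ is a complex manifold embedded holomorphically in $\mathbb{P}(\mathcal{H}^\infty)$; $M$ is then called a CS-manifold. Standing assumptions. $G$ has a complexification $G_{\mathbb{C}}$, with complex conjugation $g\mapsto\bar g$ relative to $G$, and $T$ extends holomorphically to $G_{\mathbb{C}}$ (the extension is also denoted $T$). Put $\mathfrak{b}(e_0)=\{X\in\mathfrak{g}_{\mathbb{C}}: dT(X)e_0\in\mathbb{C}e_0\}$ and $\mathfrak{b}=\overline{\mathfrak{b}(e_0)}$, and let $B\subset G_{\mathbb{C}}$ be the closed subgroup with Lie algebra $\mathfrak{b}$, so that $T(\bar b)e_0\in\mathbb{C}e_0$ for $b\in B$.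 The complex structure of $M$ is the one induced by the embedding $M\cong G/H\hookrightarrow G_{\mathbb{C}}/B$. The associated homogeneous holomorphic line bundle is assumed very ample. Coordinates and functions. Let $\mathcal{V}_0\subset M$ be the open dense set of points $gB$ with $(T(\bar g)e_0,e_0)\neq 0$. It carries holomorphic coordinates $z=(z_1,\dots,z_n)$, in which the coherent state vectors are $e_{\bar z}=\exp\big(\sum_\alpha \bar z_\alpha\, dT(X_\alpha)\big)e_0$, with $\{X_\alpha\}$ a basis of a subspace $\mathfrak{m}'\subset\mathfrak{g}_{\mathbb{C}}$ complementary to $\overline{\mathfrak{b}}=\mathfrak{b}(e_0)$. For $\psi\in\mathcal{H}$, $$f_\psi(z)=(e_{\bar z},\psi)=\frac{(T(\bar g)e_0,\psi)}{(T(\bar g)e_0,e_0)},\qquad z\leftrightarrow gB\in\mathcal{V}_0 .$$ $\Phi(\psi)=f_\psi$ is an isometry onto a reproducing kernel Hilbert space of holomorphic functions with kernel $K(z,\bar w)=(e_{\bar z},e_{\bar w})$. $\mathfrak{D}_1$ denotes the holomorphic linear differential operators of degree $\le 1$; on $\mathcal{V}_0$ these are the operators $a_0+\sum_i a_i\,\partial/\partial z_i$ with $a_0,\dots,a_n$ holomorphic on $\mathcal{V}_0$. *)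

theory Defs
  imports "HOL-Analysis.Analysis" "HOL-Algebra.Coset"
begin

section \<open>Complex normed spaces and complex Hilbert spaces\<close>

class complex_normed = real_normed_vector +
  fixes scaleC :: "complex \<Rightarrow> 'a \<Rightarrow> 'a"  (infixr \<open>*\<^sub>C\<close> 75)
  assumes scaleC_add_right: "c *\<^sub>C (x + y) = c *\<^sub>C x + c *\<^sub>C y"
    and scaleC_add_left: "(c + d) *\<^sub>C x = c *\<^sub>C x + d *\<^sub>C x"
    and scaleC_scaleC: "c *\<^sub>C d *\<^sub>C x = (c * d) *\<^sub>C x"
    and scaleC_of_real: "complex_of_real r *\<^sub>C x = r *\<^sub>R x"
    and norm_scaleC: "norm (c *\<^sub>C x) = cmod c * norm x"

instantiation complex :: complex_normed
begin
definition scaleC_complex :: "complex \<Rightarrow> complex \<Rightarrow> complex"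
  where "scaleC_complex c x = c * x"
instance
  by standard (simp_all add: scaleC_complex_def algebra_simps norm_mult scaleR_conv_of_real)
end

instantiation prod :: (complex_normed, complex_normed) complex_normed
begin
definition scaleC_prod :: "complex \<Rightarrow> 'a \<times> 'b \<Rightarrow> 'a \<times> 'b"
  where "scaleC_prod c x = (c *\<^sub>C fst x, c *\<^sub>C snd x)"
instance
proof
  fix c :: complex and x :: "'a \<times> 'b"
  have "norm (c *\<^sub>C x) = sqrt ((cmod c)\<^sup>2 * ((norm (fst x))\<^sup>2 + (norm (snd x))\<^sup>2))"
    by (simp add: scaleC_prod_def norm_prod_def norm_scaleC power_mult_distrib distrib_left)
  then show "norm (c *\<^sub>C x) = cmod c * norm x"
    by (simp add: norm_prod_def real_sqrt_mult)
qed (simp_all add: scaleC_prod_def scaleC_add_right scaleC_add_left scaleC_scaleC scaleC_of_real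
      prod_eq_iff)
end

instantiation vec :: (complex_normed, finite) complex_normed
begin
definition scaleC_vec :: "complex \<Rightarrow> 'a ^ 'b \<Rightarrow> 'a ^ 'b"
  where "scaleC_vec c x = (\<chi> i. c *\<^sub>C (x $ i))"
instance
  by standard (simp_all add: scaleC_vec_def scaleC_add_right scaleC_add_left scaleC_scaleC
      scaleC_of_real vec_eq_iff norm_vec_def norm_scaleC L2_set_right_distrib)
end

text \<open>The scalar product is antilinear in the first argument and linear in the second.\<close>

class complex_hilbert = complex_normed + banach +
  fixes cinner :: "'a \<Rightarrow> 'a \<Rightarrow> complex"
  assumes cinner_add_right: "cinner x (y + z) = cinner x y + cinner x z"
    and cinner_scaleC_right: "cinner x (c *\<^sub>C y) = c * cinner x y"
    and cinner_commute: "cinner x y = cnj (cinner y x)"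
    and norm_cinner: "complex_of_real ((norm x)\<^sup>2) = cinner x x"

instantiation complex :: complex_hilbert
begin
definition cinner_complex :: "complex \<Rightarrow> complex \<Rightarrow> complex"
  where "cinner_complex x y = cnj x * y"
instance
  by standard (simp_all add: cinner_complex_def scaleC_complex_def algebra_simps
      complex_norm_square del: of_real_power)
end

definition cline :: "'a::complex_normed \<Rightarrow> 'a set"
  where "cline v = {c *\<^sub>C v | c. True}"

definition csubspace :: "'a::complex_normed set \<Rightarrow> bool"
  where "csubspace S \<longleftrightarrow> 0 \<in> S \<and> (\<forall>x\<in>S. \<forall>y\<in>S. x + y \<in> S) \<and> (\<forall>c. \<forall>x\<in>S. c *\<^sub>C x \<in> S)"

definition clinear_on :: "'a::complex_normed set \<Rightarrow> ('a \<Rightarrow> 'b::complex_normed) \<Rightarrow> bool"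
  where "clinear_on S f \<longleftrightarrow>
    (\<forall>x\<in>S. \<forall>y\<in>S. f (x + y) = f x + f y) \<and> (\<forall>c. \<forall>x\<in>S. f (c *\<^sub>C x) = c *\<^sub>C f x)"

section \<open>Smooth and holomorphic functions on open sets\<close>

text \<open>The following predicates are meant for open sets in finite-dimensional spaces; the target
  may be a Hilbert space.\<close>

primrec Ck_on ::
  "nat \<Rightarrow> 'a::real_normed_vector set \<Rightarrow> ('a \<Rightarrow> 'b::real_normed_vector) \<Rightarrow> bool"
  where
    "Ck_on 0 S f \<longleftrightarrow> continuous_on S f"
  | "Ck_on (Suc k) S f \<longleftrightarrow> (\<forall>x\<in>S. f differentiable (at x)) \<and>
       (\<forall>v. Ck_on k S (\<lambda>x. frechet_derivative f (at x) v))"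

definition smooth_on :: "'a::real_normed_vector set \<Rightarrow> ('a \<Rightarrow> 'b::real_normed_vector) \<Rightarrow> bool"
  where "smooth_on S f \<longleftrightarrow> (\<forall>k. Ck_on k S f)"

definition holo_on :: "'a::complex_normed set \<Rightarrow> ('a \<Rightarrow> 'b::complex_normed) \<Rightarrow> bool"
  where "holo_on S f \<longleftrightarrow>
    (\<forall>x\<in>S. \<exists>D. (f has_derivative D) (at x) \<and> (\<forall>c v. D (c *\<^sub>C v) = c *\<^sub>C D v))"

definition antiholo_on :: "'a::complex_normed set \<Rightarrow> ('a \<Rightarrow> 'b::complex_normed) \<Rightarrow> bool"
  where "antiholo_on S f \<longleftrightarrow>
    (\<forall>x\<in>S. \<exists>D. (f has_derivative D) (at x) \<and> (\<forall>c v. D (c *\<^sub>C v) = cnj c *\<^sub>C D v))"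

definition cpartial :: "'n::finite \<Rightarrow> (complex ^ 'n \<Rightarrow> complex) \<Rightarrow> complex ^ 'n \<Rightarrow> complex"
  where "cpartial i f w = deriv (\<lambda>t. f (w + axis i t)) 0"

section \<open>Manifolds and Lie groups\<close>

text \<open>A chart is a pair of a domain and a coordinate map. The regularity class \<open>R\<close> is \<^const>\<open>smooth_on\<close>,
  \<^const>\<open>holo_on\<close> or \<^const>\<open>antiholo_on\<close>.\<close>

type_synonym ('a, 'e) chart = "'a set \<times> ('a \<Rightarrow> 'e)"

definition manifold ::
  "('e::real_normed_vector set \<Rightarrow> ('e \<Rightarrow> 'e) \<Rightarrow> bool) \<Rightarrow> 'a topology \<Rightarrow> ('a, 'e) chart set \<Rightarrow> bool"
  where "manifold R X A \<longleftrightarrow>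
    Hausdorff_space X \<and> second_countable X \<and> \<Union> (fst ` A) = topspace X \<and>
    (\<forall>(U, \<phi>)\<in>A. openin X U \<and> open (\<phi> ` U) \<and>
        homeomorphic_map (subtopology X U) (top_of_set (\<phi> ` U)) \<phi>) \<and>
    (\<forall>(U, \<phi>)\<in>A. \<forall>(V, \<psi>)\<in>A. R (\<phi> ` (U \<inter> V)) (\<psi> \<circ> inv_into U \<phi>))"

definition prod_atlas ::
  "('a, 'e) chart set \<Rightarrow> ('b, 'f) chart set \<Rightarrow> ('a \<times> 'b, 'e \<times> 'f) chart set"
  where "prod_atlas A B = {(U \<times> V, map_prod \<phi> \<psi>) | U \<phi> V \<psi>. (U, \<phi>) \<in> A \<and> (V, \<psi>) \<in> B}"

definition manifold_map ::
  "('e set \<Rightarrow> ('e \<Rightarrow> 'f) \<Rightarrow> bool) \<Rightarrow> 'a topology \<Rightarrow> ('a, 'e) chart set \<Rightarrow>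
    'b topology \<Rightarrow> ('b, 'f) chart set \<Rightarrow> ('a \<Rightarrow> 'b) \<Rightarrow> bool"
  where "manifold_map R X A Y B f \<longleftrightarrow> continuous_map X Y f \<and>
    (\<forall>(U, \<phi>)\<in>A. \<forall>(V, \<psi>)\<in>B. R (\<phi> ` {x \<in> U. f x \<in> V}) (\<psi> \<circ> f \<circ> inv_into U \<phi>))"

text \<open>Vector-valued functions on an open subset \<open>W\<close> of a manifold.\<close>

definition manifold_fun ::
  "('e set \<Rightarrow> ('e \<Rightarrow> 'f) \<Rightarrow> bool) \<Rightarrow> ('a, 'e) chart set \<Rightarrow> 'a set \<Rightarrow> ('a \<Rightarrow> 'f) \<Rightarrow> bool"
  where "manifold_fun R A W f \<longleftrightarrow> (\<forall>(U, \<phi>)\<in>A. R (\<phi> ` (U \<inter> W)) (f \<circ> inv_into U \<phi>))"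

record ('a, 'e) lie_group = "'a monoid" +
  topo :: "'a topology"
  atlas :: "('a, 'e) chart set"

definition real_lie_group :: "('g, real ^ 'd::finite) lie_group \<Rightarrow> bool"
  where "real_lie_group G \<longleftrightarrow> group G \<and> topspace (topo G) = carrier G \<and>
    manifold smooth_on (topo G) (atlas G) \<and>
    manifold_map smooth_on (prod_topology (topo G) (topo G)) (prod_atlas (atlas G) (atlas G))
      (topo G) (atlas G) (\<lambda>(x, y). x \<otimes>\<^bsub>G\<^esub> y) \<and>
    manifold_map smooth_on (topo G) (atlas G) (topo G) (atlas G) (\<lambda>x. inv\<^bsub>G\<^esub> x)"

definition complex_lie_group :: "('g, complex ^ 'd::finite) lie_group \<Rightarrow> bool"
  where "complex_lie_group G \<longleftrightarrow> group G \<and> topspace (topo G) = carrier G \<and>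
    manifold holo_on (topo G) (atlas G) \<and>
    manifold_map holo_on (prod_topology (topo G) (topo G)) (prod_atlas (atlas G) (atlas G))
      (topo G) (atlas G) (\<lambda>(x, y). x \<otimes>\<^bsub>G\<^esub> y) \<and>
    manifold_map holo_on (topo G) (atlas G) (topo G) (atlas G) (\<lambda>x. inv\<^bsub>G\<^esub> x)"

section \<open>Lie algebras\<close>

text \<open>The tangent space at the identity is identified with the model space by means of one fixed
  chart around the identity.\<close>

definition id_chart :: "('g, 'e, 'm) lie_group_scheme \<Rightarrow> ('g, 'e) chart"
  where "id_chart G = (SOME c. c \<in> atlas G \<and> \<one>\<^bsub>G\<^esub> \<in> fst c)"

definition one_param_subgroup ::
  "('g, 'e::real_normed_vector, 'm) lie_group_scheme \<Rightarrow> (real \<Rightarrow> 'g) \<Rightarrow> bool"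
  where "one_param_subgroup G \<gamma> \<longleftrightarrow>
    manifold_map smooth_on euclidean {(UNIV, \<lambda>t. t)} (topo G) (atlas G) \<gamma> \<and>
    (\<forall>s t. \<gamma> (s + t) = \<gamma> s \<otimes>\<^bsub>G\<^esub> \<gamma> t)"

definition velocity ::
  "('g, 'e::real_normed_vector, 'm) lie_group_scheme \<Rightarrow> (real \<Rightarrow> 'g) \<Rightarrow> 'e"
  where "velocity G \<gamma> = vector_derivative (snd (id_chart G) \<circ> \<gamma>) (at 0)"

text \<open>The Lie algebra consists of the initial velocities of the one-parameter subgroups. Since every
  tangent vector at the identity generates a unique one-parameter subgroup, this is the whole
  tangent space, and \<open>exp_curve G X t\<close> is \<open>exp(t X)\<close>.\<close>

definition lie_algebra :: "('g, 'e::real_normed_vector, 'm) lie_group_scheme \<Rightarrow> 'e set"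
  where "lie_algebra G = {velocity G \<gamma> | \<gamma>. one_param_subgroup G \<gamma>}"

definition exp_curve ::
  "('g, 'e::real_normed_vector, 'm) lie_group_scheme \<Rightarrow> 'e \<Rightarrow> real \<Rightarrow> 'g"
  where "exp_curve G X = (SOME \<gamma>. one_param_subgroup G \<gamma> \<and> velocity G \<gamma> = X)"

definition subgroup_lie_algebra ::
  "('g, 'e::real_normed_vector, 'm) lie_group_scheme \<Rightarrow> 'g set \<Rightarrow> 'e set"
  where "subgroup_lie_algebra G B = {X \<in> lie_algebra G. \<forall>t. exp_curve G X t \<in> B}"

text \<open>Differential at the identity of a map preserving identities.\<close>

definition diff_id ::
  "('g, 'e::real_normed_vector, 'm) lie_group_scheme \<Rightarrow>
    ('h, 'f::real_normed_vector, 'k) lie_group_scheme \<Rightarrow> ('g \<Rightarrow> 'h) \<Rightarrow> 'e \<Rightarrow> 'f"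
  where "diff_id G K f = frechet_derivative
    (snd (id_chart K) \<circ> f \<circ> inv_into (fst (id_chart G)) (snd (id_chart G)))
    (at (snd (id_chart G) \<one>\<^bsub>G\<^esub>))"

text \<open>The complexification of \<open>real ^ 'd\<close> is \<open>complex ^ 'd\<close>, an element being
  \<open>vec_Re Z + i vec_Im Z\<close>.\<close>

definition vec_Re :: "complex ^ 'd::finite \<Rightarrow> real ^ 'd"
  where "vec_Re Z = (\<chi> j. Re (Z $ j))"

definition vec_Im :: "complex ^ 'd::finite \<Rightarrow> real ^ 'd"
  where "vec_Im Z = (\<chi> j. Im (Z $ j))"

definition vec_cnj :: "complex ^ 'd::finite \<Rightarrow> complex ^ 'd"
  where "vec_cnj Z = (\<chi> j. cnj (Z $ j))"

definition lie_algebra_C :: "('g, real ^ 'd::finite) lie_group \<Rightarrow> (complex ^ 'd) set"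
  where "lie_algebra_C G = {Z. vec_Re Z \<in> lie_algebra G \<and> vec_Im Z \<in> lie_algebra G}"

definition diff_id_C ::
  "('g, real ^ 'd::finite) lie_group \<Rightarrow> ('k, complex ^ 'd) lie_group \<Rightarrow> ('g \<Rightarrow> 'k) \<Rightarrow>
    complex ^ 'd \<Rightarrow> complex ^ 'd"
  where "diff_id_C G GC \<iota> Z =
    diff_id G GC \<iota> (vec_Re Z) + \<i> *\<^sub>C diff_id G GC \<iota> (vec_Im Z)"

text \<open>\<open>GC\<close> is a complexification of \<open>G\<close> via the inclusion \<open>\<iota>\<close>, and \<open>\<sigma>\<close> is the complex conjugation.\<close>

definition complexification ::
  "('g, real ^ 'd::finite) lie_group \<Rightarrow> ('k, complex ^ 'd) lie_group \<Rightarrow>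
    ('g \<Rightarrow> 'k) \<Rightarrow> ('k \<Rightarrow> 'k) \<Rightarrow> bool"
  where "complexification G GC \<iota> \<sigma> \<longleftrightarrow>
    real_lie_group G \<and> complex_lie_group GC \<and>
    \<iota> \<in> hom G GC \<and> inj_on \<iota> (carrier G) \<and>
    manifold_map smooth_on (topo G) (atlas G) (topo GC) (atlas GC) \<iota> \<and>
    bij (diff_id_C G GC \<iota>) \<and>
    \<sigma> \<in> hom GC GC \<and> (\<forall>g\<in>carrier GC. \<sigma> (\<sigma> g) = g) \<and>
    manifold_map antiholo_on (topo GC) (atlas GC) (topo GC) (atlas GC) \<sigma> \<and>
    (\<forall>g\<in>carrier G. \<sigma> (\<iota> g) = \<iota> g)"

section \<open>Unitary representations\<close>

definition unitary_rep ::
  "('g, real ^ 'd::finite) lie_group \<Rightarrow> ('g \<Rightarrow> 'h \<Rightarrow> 'h::complex_hilbert) \<Rightarrow> bool"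
  where "unitary_rep G T \<longleftrightarrow>
    (\<forall>g\<in>carrier G. clinear_on UNIV (T g) \<and> surj (T g) \<and>
        (\<forall>v w. cinner (T g v) (T g w) = cinner v w)) \<and>
    T \<one>\<^bsub>G\<^esub> = id \<and>
    (\<forall>g\<in>carrier G. \<forall>h\<in>carrier G. T (g \<otimes>\<^bsub>G\<^esub> h) = T g \<circ> T h) \<and>
    (\<forall>v. continuous_map (topo G) euclidean (\<lambda>g. T g v))"

definition smooth_vectors ::
  "('g, real ^ 'd::finite) lie_group \<Rightarrow> ('g \<Rightarrow> 'h \<Rightarrow> 'h::complex_hilbert) \<Rightarrow> 'h set"
  where "smooth_vectors G T = {v. manifold_fun smooth_on (atlas G) (carrier G) (\<lambda>g. T g v)}"

definition dT ::
  "('g, real ^ 'd::finite) lie_group \<Rightarrow> ('g \<Rightarrow> 'h \<Rightarrow> 'h::complex_hilbert) \<Rightarrow> real ^ 'd \<Rightarrow> 'h \<Rightarrow> 'h"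
  where "dT G T X v = vector_derivative (\<lambda>t. T (exp_curve G X t) v) (at 0)"

definition dTC ::
  "('g, real ^ 'd::finite) lie_group \<Rightarrow> ('g \<Rightarrow> 'h \<Rightarrow> 'h::complex_hilbert) \<Rightarrow> complex ^ 'd \<Rightarrow> 'h \<Rightarrow> 'h"
  where "dTC G T Z v = dT G T (vec_Re Z) v + \<i> *\<^sub>C dT G T (vec_Im Z) v"

definition cyclic_vector ::
  "('g, real ^ 'd::finite) lie_group \<Rightarrow> ('g \<Rightarrow> 'h \<Rightarrow> 'h::complex_hilbert) \<Rightarrow> 'h \<Rightarrow> bool"
  where "cyclic_vector G T e0 \<longleftrightarrow> closure (span {c *\<^sub>C T g e0 | c g. g \<in> carrier G}) = UNIV"

text \<open>The topology of the space of smooth vectors is the coarsest one that makes all iterated derivatives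
  \<open>v \<mapsto> dT(X1) ... dT(Xk) v\<close> continuous.\<close>

definition dT_list ::
  "('g, real ^ 'd::finite) lie_group \<Rightarrow> ('g \<Rightarrow> 'h \<Rightarrow> 'h::complex_hilbert) \<Rightarrow>
    (real ^ 'd) list \<Rightarrow> 'h \<Rightarrow> 'h"
  where "dT_list G T Xs v = foldr (dT G T) Xs v"

definition smooth_vectors_topology ::
  "('g, real ^ 'd::finite) lie_group \<Rightarrow> ('g \<Rightarrow> 'h \<Rightarrow> 'h::complex_hilbert) \<Rightarrow> 'h topology"
  where "smooth_vectors_topology G T = topology_generated_by
    {{v \<in> smooth_vectors G T. dT_list G T Xs v \<in> W} | Xs W. Xs \<in> lists (lie_algebra G) \<and> open W}"

section \<open>Quotient spaces\<close>

definition quot_topology :: "'a topology \<Rightarrow> ('a \<Rightarrow> 'b) \<Rightarrow> 'b topology"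
  where "quot_topology X p =
    topology (\<lambda>W. W \<subseteq> p ` topspace X \<and> openin X {x \<in> topspace X. p x \<in> W})"

lemma openin_quot_topology:
  "openin (quot_topology X p) W \<longleftrightarrow>
    W \<subseteq> p ` topspace X \<and> openin X {x \<in> topspace X. p x \<in> W}"
proof -
  have "istopology (\<lambda>W. W \<subseteq> p ` topspace X \<and> openin X {x \<in> topspace X. p x \<in> W})"
    unfolding istopology_def
  proof (intro conjI allI impI)
    fix S T
    assume S: "S \<subseteq> p ` topspace X \<and> openin X {x \<in> topspace X. p x \<in> S}"
      and T: "T \<subseteq> p ` topspace X \<and> openin X {x \<in> topspace X. p x \<in> T}"
    show "S \<inter> T \<subseteq> p ` topspace X" using S by blast
    have "{x \<in> topspace X. p x \<in> S \<inter> T} =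
        {x \<in> topspace X. p x \<in> S} \<inter> {x \<in> topspace X. p x \<in> T}" by blast
    then show "openin X {x \<in> topspace X. p x \<in> S \<inter> T}" using S T by (simp add: openin_Int)
  next
    fix K
    assume K: "\<forall>S\<in>K. S \<subseteq> p ` topspace X \<and> openin X {x \<in> topspace X. p x \<in> S}"
    show "\<Union> K \<subseteq> p ` topspace X" using K by blast
    have "{x \<in> topspace X. p x \<in> \<Union> K} = (\<Union>S\<in>K. {x \<in> topspace X. p x \<in> S})" by blast
    then show "openin X {x \<in> topspace X. p x \<in> \<Union> K}" using K by auto
  qed
  then show ?thesis by (simp add: quot_topology_def topology_inverse')
qed

definition coset_space ::
  "('g, 'e, 'm) lie_group_scheme \<Rightarrow> 'g set \<Rightarrow> 'g set topology"
  where "coset_space G B = quot_topology (topo G) (\<lambda>g. g <#\<^bsub>G\<^esub> B)"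

text \<open>Points of the projective space of the smooth vectors are complex lines.\<close>

definition proj_smooth ::
  "('g, real ^ 'd::finite) lie_group \<Rightarrow> ('g \<Rightarrow> 'h \<Rightarrow> 'h::complex_hilbert) \<Rightarrow> 'h set topology"
  where "proj_smooth G T = quot_topology (subtopology (smooth_vectors_topology G T) (- {0})) cline"

section \<open>Coherent state representations\<close>

text \<open>\<open>M\<close> is an embedded complex submanifold of the projective space, of dimension \<open>CARD('n)\<close>: locally it is
  parametrized by the classes of a nowhere vanishing holomorphic map \<open>s\<close> into the space of smooth
  vectors; the parametrization is a homeomorphism onto an open part of \<open>M\<close> and an immersion, i.e.
  the derivative of \<open>s\<close> is injective modulo the line through \<open>s w\<close>.\<close>

definition proj_complex_submanifold ::
  "'n::finite itself \<Rightarrow> ('g, real ^ 'd::finite) lie_group \<Rightarrow>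
    ('g \<Rightarrow> 'h \<Rightarrow> 'h::complex_hilbert) \<Rightarrow> 'h set set \<Rightarrow> bool"
  where "proj_complex_submanifold _ G T M \<longleftrightarrow>
    (\<forall>p\<in>M. \<exists>W (U :: (complex ^ 'n) set) s.
       openin (proj_smooth G T) W \<and> p \<in> W \<and> open U \<and> s ` U \<subseteq> smooth_vectors G T - {0} \<and>
       (\<forall>Xs\<in>lists (lie_algebra G). holo_on U (\<lambda>w. dT_list G T Xs (s w))) \<and>
       homeomorphic_map (top_of_set U) (subtopology (proj_smooth G T) (M \<inter> W)) (\<lambda>w. cline (s w)) \<and>
       (\<forall>w\<in>U. \<forall>v. v \<noteq> 0 \<longrightarrow> frechet_derivative s (at w) v \<notin> cline (s w)))"

definition cs_representation ::
  "'n::finite itself \<Rightarrow> ('g, real ^ 'd::finite) lie_group \<Rightarrow>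
    ('g \<Rightarrow> 'h \<Rightarrow> 'h::complex_hilbert) \<Rightarrow> 'h \<Rightarrow> bool"
  where "cs_representation n G T e0 \<longleftrightarrow>
    unitary_rep G T \<and> e0 \<in> smooth_vectors G T \<and> norm e0 = 1 \<and> cyclic_vector G T e0 \<and>
    proj_complex_submanifold n G T {cline (T g e0) | g. g \<in> carrier G}"

definition line_stabilizer ::
  "('g, real ^ 'd::finite) lie_group \<Rightarrow> ('g \<Rightarrow> 'h \<Rightarrow> 'h::complex_hilbert) \<Rightarrow> 'h \<Rightarrow> 'g set"
  where "line_stabilizer G T e0 = {g \<in> carrier G. T g e0 \<in> cline e0}"

definition lie_line_stabilizer ::
  "('g, real ^ 'd::finite) lie_group \<Rightarrow> ('g \<Rightarrow> 'h \<Rightarrow> 'h::complex_hilbert) \<Rightarrow> 'h \<Rightarrow> (complex ^ 'd) set"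
  where "lie_line_stabilizer G T e0 = {Z \<in> lie_algebra_C G. dTC G T Z e0 \<in> cline e0}"

text \<open>\<open>TC\<close> extends \<open>T\<close> holomorphically to \<open>GC\<close>. The operators \<open>TC g\<close> are in general unbounded; they act
  on a common invariant domain \<open>D\<close> of smooth vectors.\<close>

definition holomorphic_extension ::
  "('g, real ^ 'd::finite) lie_group \<Rightarrow> ('k, complex ^ 'd) lie_group \<Rightarrow> ('g \<Rightarrow> 'k) \<Rightarrow>
    ('g \<Rightarrow> 'h \<Rightarrow> 'h::complex_hilbert) \<Rightarrow> 'h set \<Rightarrow> ('k \<Rightarrow> 'h \<Rightarrow> 'h) \<Rightarrow> bool"
  where "holomorphic_extension G GC \<iota> T D TC \<longleftrightarrow>
    csubspace D \<and> D \<subseteq> smooth_vectors G T \<and>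
    (\<forall>g\<in>carrier GC. clinear_on D (TC g) \<and> TC g ` D \<subseteq> D) \<and>
    (\<forall>g\<in>carrier GC. \<forall>h\<in>carrier GC. \<forall>v\<in>D. TC (g \<otimes>\<^bsub>GC\<^esub> h) v = TC g (TC h v)) \<and>
    (\<forall>v\<in>D. manifold_fun holo_on (atlas GC) (carrier GC) (\<lambda>g. TC g v)) \<and>
    (\<forall>g\<in>carrier G. \<forall>v\<in>D. TC (\<iota> g) v = T g v)"

text \<open>\<open>B\<close> is the closed subgroup with Lie algebra \<open>conj (b(e0))\<close>, and \<open>gH \<mapsto> \<iota>(g)B\<close>, written as multiplication of
  sets, is an open embedding of \<open>G/H\<close> into \<open>GC/B\<close>.\<close>

definition cs_homogeneous_embedding ::
  "('g, real ^ 'd::finite) lie_group \<Rightarrow> ('k, complex ^ 'd) lie_group \<Rightarrow> ('g \<Rightarrow> 'k) \<Rightarrow> ('k \<Rightarrow> 'k) \<Rightarrow>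
    ('g \<Rightarrow> 'h \<Rightarrow> 'h::complex_hilbert) \<Rightarrow> ('k \<Rightarrow> 'h \<Rightarrow> 'h) \<Rightarrow> 'h \<Rightarrow> 'k set \<Rightarrow> bool"
  where "cs_homogeneous_embedding G GC \<iota> \<sigma> T TC e0 B \<longleftrightarrow>
    subgroup B GC \<and> closedin (topo GC) B \<and>
    subgroup_lie_algebra GC B = diff_id_C G GC \<iota> ` vec_cnj ` lie_line_stabilizer G T e0 \<and>
    (\<forall>b\<in>B. TC (\<sigma> b) e0 \<in> cline e0) \<and>
    (let H = line_stabilizer G T e0; j = (\<lambda>C. \<iota> ` C <#>\<^bsub>GC\<^esub> B) in
      embedding_map (coset_space G H) (coset_space GC B) j \<and>
      open_map (coset_space G H) (coset_space GC B) j)"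

definition cs_manifold ::
  "('g, real ^ 'd::finite) lie_group \<Rightarrow> ('k, complex ^ 'd) lie_group \<Rightarrow> ('g \<Rightarrow> 'k) \<Rightarrow> 'k set \<Rightarrow>
    'k set set"
  where "cs_manifold G GC \<iota> B = {\<iota> g <#\<^bsub>GC\<^esub> B | g. g \<in> carrier G}"

text \<open>Holomorphic functions on an open part of \<open>GC/B\<close> are those whose pullback to \<open>GC\<close> is holomorphic.\<close>

definition coset_holo ::
  "('k, complex ^ 'd::finite) lie_group \<Rightarrow> 'k set \<Rightarrow> 'k set set \<Rightarrow> ('k set \<Rightarrow> complex) \<Rightarrow> bool"
  where "coset_holo GC B W f \<longleftrightarrow> manifold_fun holo_on (atlas GC) (\<Union> W) (\<lambda>g. f (g <#\<^bsub>GC\<^esub> B))"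

definition holomorphic_coordinates ::
  "('k, complex ^ 'd::finite) lie_group \<Rightarrow> 'k set \<Rightarrow> 'k set set \<Rightarrow>
    ('k set \<Rightarrow> complex ^ 'n::finite) \<Rightarrow> bool"
  where "holomorphic_coordinates GC B V z \<longleftrightarrow>
    open (z ` V) \<and> homeomorphic_map (subtopology (coset_space GC B) V) (top_of_set (z ` V)) z \<and>
    (\<forall>W f. W \<subseteq> V \<longrightarrow> openin (coset_space GC B) W \<longrightarrow>
       (coset_holo GC B W f \<longleftrightarrow> holo_on (z ` W) (f \<circ> inv_into V z)))"

text \<open>The holomorphic sections over \<open>M\<close> of the homogeneous line bundle whose character is given by
  \<open>T(conj b) e0 = cnj (\<chi> b) e0\<close>; they include all functions \<open>g \<mapsto> (T(conj g) e0, \<psi>)\<close>.\<close>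

definition cs_sections ::
  "('k, complex ^ 'd::finite) lie_group \<Rightarrow> ('k \<Rightarrow> 'k) \<Rightarrow> ('k \<Rightarrow> 'h \<Rightarrow> 'h::complex_hilbert) \<Rightarrow> 'h \<Rightarrow>
    'k set \<Rightarrow> 'k set set \<Rightarrow> ('k \<Rightarrow> complex) set"
  where "cs_sections GC \<sigma> TC e0 B M =
    {F. manifold_fun holo_on (atlas GC) (\<Union> M) F \<and>
        (\<forall>g\<in>\<Union> M. \<forall>b\<in>B. F (g \<otimes>\<^bsub>GC\<^esub> b) = cinner (TC (\<sigma> b) e0) e0 * F g)}"

text \<open>Very ampleness: the map of \<open>M\<close> into the projective space of the dual of the space of sections is
  well-defined, injective and immersive.\<close>

definition cs_very_ample ::
  "('k, complex ^ 'd::finite) lie_group \<Rightarrow> ('k \<Rightarrow> 'k) \<Rightarrow> ('k \<Rightarrow> 'h \<Rightarrow> 'h::complex_hilbert) \<Rightarrow> 'h \<Rightarrow>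
    'k set \<Rightarrow> 'k set set \<Rightarrow> bool"
  where "cs_very_ample GC \<sigma> TC e0 B M \<longleftrightarrow>
    (\<forall>g\<in>\<Union> M. \<exists>F\<in>cs_sections GC \<sigma> TC e0 B M. F g \<noteq> 0) \<and>
    (\<forall>g\<in>\<Union> M. \<forall>h\<in>\<Union> M. g <#\<^bsub>GC\<^esub> B \<noteq> h <#\<^bsub>GC\<^esub> B \<longrightarrow>
       (\<exists>F\<in>cs_sections GC \<sigma> TC e0 B M. F g = 0 \<and> F h \<noteq> 0)) \<and>
    (\<forall>g\<in>\<Union> M. \<forall>Z\<in>lie_algebra GC - subgroup_lie_algebra GC B.
       \<exists>F\<in>cs_sections GC \<sigma> TC e0 B M. F g = 0 \<and>
         vector_derivative (\<lambda>t. F (g \<otimes>\<^bsub>GC\<^esub> exp_curve GC Z t)) (at 0) \<noteq> 0)"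

definition cs_domain ::
  "('k, complex ^ 'd::finite) lie_group \<Rightarrow> ('k \<Rightarrow> 'k) \<Rightarrow> ('k \<Rightarrow> 'h \<Rightarrow> 'h::complex_hilbert) \<Rightarrow> 'h \<Rightarrow>
    'k set \<Rightarrow> 'k set set \<Rightarrow> 'k set set"
  where "cs_domain GC \<sigma> TC e0 B M =
    {g <#\<^bsub>GC\<^esub> B | g. g \<in> carrier GC \<and> g <#\<^bsub>GC\<^esub> B \<in> M \<and> cinner (TC (\<sigma> g) e0) e0 \<noteq> 0}"

definition complementary_basis ::
  "('g, real ^ 'd::finite) lie_group \<Rightarrow> (complex ^ 'd) set \<Rightarrow> ('n::finite \<Rightarrow> complex ^ 'd) \<Rightarrow> bool"
  where "complementary_basis G S X \<longleftrightarrow>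
    inj X \<and> vec.independent (range X) \<and> range X \<subseteq> lie_algebra_C G \<and>
    vec.span (range X) \<inter> S = {0} \<and>
    {x + y | x y. x \<in> vec.span (range X) \<and> y \<in> S} = lie_algebra_C G"

text \<open>The \<open>k\<close>-th term of the exponential series of \<open>\<Sum>\<alpha>. cnj (w $ \<alpha>) dT(X \<alpha>)\<close> applied to \<open>e0\<close>. The
  coherent state vector belonging to the coordinates \<open>w\<close> is \<open>coherent_state G T e0 X w\<close>.\<close>

definition coherent_term ::
  "('g, real ^ 'd::finite) lie_group \<Rightarrow> ('g \<Rightarrow> 'h \<Rightarrow> 'h::complex_hilbert) \<Rightarrow> 'h \<Rightarrow>
    ('n::finite \<Rightarrow> complex ^ 'd) \<Rightarrow> complex ^ 'n \<Rightarrow> nat \<Rightarrow> 'h"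
  where "coherent_term G T e0 X w k =
    (1 / fact k) *\<^sub>C (((\<lambda>v. \<Sum>\<alpha>\<in>UNIV. cnj (w $ \<alpha>) *\<^sub>C dTC G T (X \<alpha>) v) ^^ k) e0)"

definition coherent_state ::
  "('g, real ^ 'd::finite) lie_group \<Rightarrow> ('g \<Rightarrow> 'h \<Rightarrow> 'h::complex_hilbert) \<Rightarrow> 'h \<Rightarrow>
    ('n::finite \<Rightarrow> complex ^ 'd) \<Rightarrow> complex ^ 'n \<Rightarrow> 'h"
  where "coherent_state G T e0 X w = (\<Sum>k. coherent_term G T e0 X w k)"

definition cs_transform ::
  "('g, real ^ 'd::finite) lie_group \<Rightarrow> ('g \<Rightarrow> 'h \<Rightarrow> 'h::complex_hilbert) \<Rightarrow> 'h \<Rightarrow>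
    ('n::finite \<Rightarrow> complex ^ 'd) \<Rightarrow> 'h \<Rightarrow> complex ^ 'n \<Rightarrow> complex"
  where "cs_transform G T e0 X \<psi> w = cinner (coherent_state G T e0 X w) \<psi>"

text \<open>Holomorphic coordinates \<open>z\<close> on the domain \<open>V\<close> in which
  \<open>T(conj g) e0 / (e0, T(conj g) e0)\<close> is the coherent state vector of \<open>z (g B)\<close>.\<close>

definition coherent_coordinates ::
  "('g, real ^ 'd::finite) lie_group \<Rightarrow> ('k, complex ^ 'd) lie_group \<Rightarrow> ('k \<Rightarrow> 'k) \<Rightarrow>
    ('g \<Rightarrow> 'h \<Rightarrow> 'h::complex_hilbert) \<Rightarrow> ('k \<Rightarrow> 'h \<Rightarrow> 'h) \<Rightarrow> 'h \<Rightarrow> 'k set \<Rightarrow> 'k set set \<Rightarrow>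
    ('n::finite \<Rightarrow> complex ^ 'd) \<Rightarrow> ('k set \<Rightarrow> complex ^ 'n) \<Rightarrow> bool"
  where "coherent_coordinates G GC \<sigma> T TC e0 B V X z \<longleftrightarrow>
    complementary_basis G (lie_line_stabilizer G T e0) X \<and>
    holomorphic_coordinates GC B V z \<and>
    (\<forall>g\<in>\<Union> V. coherent_term G T e0 X (z (g <#\<^bsub>GC\<^esub> B)) sums
       ((1 / cinner e0 (TC (\<sigma> g) e0)) *\<^sub>C TC (\<sigma> g) e0))"

end

theory Submission
  imports Defs "HOL-Complex_Analysis.Cauchy_Integral_Formula" "HOL-Algebra.Left_Coset"
begin

text \<open>For \<open>Y\<close> in the real Lie algebra and \<open>w = z(gB)\<close>, unitarity moves \<open>T(exp tY)\<close> to the coherent state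
  vector, where it becomes left translation of \<open>g\<close> by \<open>exp(-tY)\<close>. Hence \<open>(e\<^sub>w, T(exp tY) \<psi>)\<close> is
  \<open>(e\<^sub>w, T(exp tY) e\<^sub>0)\<close> times the value of \<open>f\<^sub>\<psi>\<close> at the translated point. Differentiating at \<open>t = 0\<close>
  gives the operator with zeroth order term the transform of \<open>dT(Y) e\<^sub>0\<close> and with the vector field
  induced by left translation. The vector field is holomorphic because a directional derivative of
  a holomorphic function of several variables is holomorphic, by Cauchy's integral formula.\<close>

section \<open>Holomorphic functions of several variables\<close>

text \<open>\<open>TC\<close> acts only on \<open>D\<close>, while \<open>\<psi>\<close> is an
  arbitrary smooth vector, so group elements can be shifted only onto the \<open>e0\<close> side of
  the scalar product. The shift rests on unitarity, which holds on \<open>G\<close>; hence the real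
  \<open>Y\<close>, with complex elements reached by linearity afterwards. The translated vector
  keeps the normalisation belonging to \<open>g\<close>, so pairing with it is not yet the transform
  at the translated point. The correcting factor does not involve \<open>\<psi>\<close>; it is
  identified by inserting \<open>\<psi> = e0\<close>, whose transform is constantly 1 on the domain.
  This also forces the zeroth order coefficient. As \<open>V0\<close> need not be invariant under
  translation, the factorisation is available for small t only, which makes openness of the preimage
  of \<open>V0\<close> in \<open>GC\<close> essential. The analytic obstacle is that
  \<open>holo_on\<close> asks for a complex-linear derivative at each point and nothing about its
  dependence on the point. The vector field differentiates the group product in its first argument
  and must be holomorphic in the second, so this dependence has to be controlled.\<close>

lemma scaleC_one [simp]: "1 *\<^sub>C x = (x::'a::complex_normed)"
  using scaleC_of_real[of 1 x] by simp

lemma scaleC_zero_left [simp]: "0 *\<^sub>C x = (0::'a::complex_normed)"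
  using scaleC_of_real[of 0 x] by simp

lemma scaleC_zero_right [simp]: "c *\<^sub>C 0 = (0::'a::complex_normed)"
  using norm_scaleC[of c "0::'a"] by simp

lemma scaleR_scaleC: "r *\<^sub>R x = complex_of_real r *\<^sub>C (x::'a::complex_normed)"
  by (simp add: scaleC_of_real)

lemma bounded_bilinear_scaleC:
  "bounded_bilinear (scaleC :: complex \<Rightarrow> 'a \<Rightarrow> 'a::complex_normed)"
proof
  fix a b :: complex and x y :: 'a and r :: real
  show "(a + b) *\<^sub>C x = a *\<^sub>C x + b *\<^sub>C x" by (rule scaleC_add_left)
  show "a *\<^sub>C (x + y) = a *\<^sub>C x + a *\<^sub>C y" by (rule scaleC_add_right)
  show "(r *\<^sub>R a) *\<^sub>C x = r *\<^sub>R a *\<^sub>C x"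
    by (simp add: scaleR_scaleC[of r "a *\<^sub>C x"] scaleC_scaleC scaleR_conv_of_real)
  show "a *\<^sub>C r *\<^sub>R x = r *\<^sub>R a *\<^sub>C x"
    by (simp add: scaleR_scaleC scaleC_scaleC mult.commute)
  show "\<exists>K. \<forall>a (b::'a). norm (a *\<^sub>C b) \<le> norm a * norm b * K"
    by (intro exI[of _ 1]) (simp add: norm_scaleC)
qed

lemmas continuous_on_scaleC [continuous_intros] =
  bounded_bilinear.continuous_on[OF bounded_bilinear_scaleC]

text \<open>Derivatives at a point are unique, so the choice made by
  \<open>frechet_derivative\<close> is the complex-linear witness.\<close>

lemma holo_onD:
  assumes "holo_on S f" "x \<in> S"
  shows "(f has_derivative frechet_derivative f (at x)) (at x)"
    and "frechet_derivative f (at x) (c *\<^sub>C v) = c *\<^sub>C frechet_derivative f (at x) v"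
  using assms unfolding holo_on_def by (metis frechet_derivative_at)+

lemma holo_on_subset: "holo_on S f \<Longrightarrow> T \<subseteq> S \<Longrightarrow> holo_on T f"
  by (auto simp: holo_on_def)

lemma holo_on_imp_continuous_on: "holo_on S f \<Longrightarrow> continuous_on S f"
  by (meson continuous_at_imp_continuous_on has_derivative_continuous holo_on_def)

text \<open>Chart expressions built with \<open>inv_into\<close> agree only on \<open>S\<close>,
  while derivatives are taken over full neighbourhoods; openness of \<open>S\<close> reconciles the
  two.\<close>

lemma holo_on_cong:
  assumes "holo_on S f" "open S" "\<And>x. x \<in> S \<Longrightarrow> f x = g x"
  shows "holo_on S g"
  using assms unfolding holo_on_def by (metis has_derivative_transform_within_open)

lemma holo_on_compose:
  assumes "holo_on S f" "holo_on T g" "f ` S \<subseteq> T"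
  shows "holo_on S (g \<circ> f)"
  unfolding holo_on_def
proof
  fix x assume x: "x \<in> S"
  obtain D where D: "(f has_derivative D) (at x)" "\<forall>c v. D (c *\<^sub>C v) = c *\<^sub>C D v"
    using assms(1) x by (auto simp: holo_on_def)
  obtain E where E: "(g has_derivative E) (at (f x))" "\<forall>c v. E (c *\<^sub>C v) = c *\<^sub>C E v"
    using assms(2,3) x unfolding holo_on_def by blast
  show "\<exists>D. (g \<circ> f has_derivative D) (at x) \<and> (\<forall>c v. D (c *\<^sub>C v) = c *\<^sub>C D v)"
    using diff_chain_at[OF D(1) E(1)] D(2) E(2) by (intro exI[of _ "E \<circ> D"]) auto
qed

lemma holo_on_add:
  fixes f g :: "'a::complex_normed \<Rightarrow> 'b::complex_normed"
  assumes "holo_on S f" "holo_on S g"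
  shows "holo_on S (\<lambda>x. f x + g x)"
  unfolding holo_on_def
proof
  fix x assume x: "x \<in> S"
  obtain D where D: "(f has_derivative D) (at x)" "\<forall>c v. D (c *\<^sub>C v) = c *\<^sub>C D v"
    using assms(1) x by (auto simp: holo_on_def)
  obtain E where E: "(g has_derivative E) (at x)" "\<forall>c v. E (c *\<^sub>C v) = c *\<^sub>C E v"
    using assms(2) x by (auto simp: holo_on_def)
  show "\<exists>D. ((\<lambda>x. f x + g x) has_derivative D) (at x) \<and> (\<forall>c v. D (c *\<^sub>C v) = c *\<^sub>C D v)"
    using has_derivative_add[OF D(1) E(1)] D(2) E(2)
    by (intro exI[of _ "\<lambda>v. D v + E v"]) (simp add: scaleC_add_right)
qed

lemma holo_on_scaleC:
  fixes f :: "'a::complex_normed \<Rightarrow> 'b::complex_normed"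
  assumes "holo_on S f"
  shows "holo_on S (\<lambda>x. c *\<^sub>C f x)"
  unfolding holo_on_def
proof
  fix x assume x: "x \<in> S"
  obtain D where D: "(f has_derivative D) (at x)" "\<forall>c v. D (c *\<^sub>C v) = c *\<^sub>C D v"
    using assms(1) x by (auto simp: holo_on_def)
  show "\<exists>D. ((\<lambda>x. c *\<^sub>C f x) has_derivative D) (at x) \<and> (\<forall>c v. D (c *\<^sub>C v) = c *\<^sub>C D v)"
    using bounded_linear.has_derivative[OF bounded_bilinear.bounded_linear_right[OF
      bounded_bilinear_scaleC, of c] D(1)] D(2)
    by (intro exI[of _ "\<lambda>v. c *\<^sub>C D v"]) (simp add: scaleC_scaleC mult.commute)
qed

lemma bounded_linear_scaleC_left: "bounded_linear (\<lambda>c. c *\<^sub>C (v::'a::complex_normed))"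
  by (rule bounded_bilinear.bounded_linear_left[OF bounded_bilinear_scaleC])

section \<open>Cauchy's formula for directional derivatives\<close>

lemma holo_on_complex_line:
  fixes F :: "'a::complex_normed \<Rightarrow> complex"
  assumes "holo_on S F" "x + c *\<^sub>C v \<in> S"
  shows "((\<lambda>\<tau>. F (x + \<tau> *\<^sub>C v)) has_field_derivative
    frechet_derivative F (at (x + c *\<^sub>C v)) v) (at c)"
proof -
  let ?D = "frechet_derivative F (at (x + c *\<^sub>C v))"
  have "((\<lambda>\<tau>. x + \<tau> *\<^sub>C v) has_derivative (\<lambda>\<tau>. 0 + \<tau> *\<^sub>C v)) (at c)"
    by (intro has_derivative_add has_derivative_const
        bounded_linear.has_derivative[OF bounded_linear_scaleC_left] has_derivative_ident)
  from diff_chain_at[OF this holo_onD(1)[OF assms]]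
  have "((\<lambda>\<tau>. F (x + \<tau> *\<^sub>C v)) has_derivative (\<lambda>\<tau>. ?D (\<tau> *\<^sub>C v))) (at c)"
    by (simp add: o_def)
  then show ?thesis
    unfolding has_field_derivative_def
    by (simp add: holo_onD(2)[OF assms] scaleC_complex_def mult_commute_abs)
qed

text \<open>A single radius serves all centres near \<open>x0\<close>, so one integral formula with
  a fixed contour holds on a whole neighbourhood and can be differentiated in the centre.\<close>

lemma open_uniform_disc:
  fixes v :: "'a::complex_normed"
  assumes "open S" "x0 \<in> S"
  obtains \<delta> r where "\<delta> > 0" "r > 0"
    "\<And>x c. x \<in> ball x0 \<delta> \<Longrightarrow> cmod c \<le> r \<Longrightarrow> x + c *\<^sub>C v \<in> S"
proof -
  obtain e where e: "e > 0" "ball x0 e \<subseteq> S"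
    using assms open_contains_ball by blast
  \<comment> \<open>Half of \<open>e\<close> is reserved for moving the centre and half for the
    disc; the summand 1 covers \<open>v = 0\<close>.\<close>
  define r where "r = e / (2 * (norm v + 1))"
  have r: "r > 0" using e by (simp add: r_def add_nonneg_pos)
  have rv: "r * norm v < e / 2"
  proof -
    have "r * norm v < r * (norm v + 1)" using r by simp
    also have "\<dots> = e / 2" 
      by (simp add: r_def field_simps add_nonneg_eq_0_iff)
    finally show ?thesis .
  qed
  show thesis
  proof (rule that[of "e/2" r])
    fix x c assume "x \<in> ball x0 (e/2)" "cmod c \<le> r"
    then have "norm (x + c *\<^sub>C v - x0) < e"
      using rv norm_triangle_ineq[of "x - x0" "c *\<^sub>C v"] mult_right_mono[of "cmod c" r "norm v"]
      by (simp add: dist_norm norm_minus_commute norm_scaleC algebra_simps)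
    then show "x + c *\<^sub>C v \<in> S" using e(2) by (auto simp: dist_norm norm_minus_commute)
  qed (use e r in auto)
qed

text \<open>This is \<open>circlepath 0 r\<close>, written out so that it can appear under an
  ordinary integral over the unit interval.\<close>

definition circ :: "real \<Rightarrow> real \<Rightarrow> complex"
  where "circ r t = of_real r * exp (2 * of_real pi * \<i> * of_real t)"

lemma norm_circ: "r \<ge> 0 \<Longrightarrow> cmod (circ r t) = r"
  by (simp add: circ_def norm_mult)

lemma circ_nonzero: "r > 0 \<Longrightarrow> circ r t \<noteq> 0"
  by (simp add: circ_def)

lemma continuous_on_circ [continuous_intros]:
  "continuous_on S f \<Longrightarrow> continuous_on S (\<lambda>x. circ r (f x))"
  unfolding circ_def by (intro continuous_intros)

text \<open>Cauchy's formula for the first derivative of the restriction to a complex line. The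
  velocity of the circle is 2 pi i times \<open>circ r t\<close>, which cancels the prefactor and
  one of the two powers in the denominator.\<close>

lemma frechet_derivative_integral_circle:
  fixes F :: "'a::complex_normed \<Rightarrow> complex"
  assumes hol: "holo_on S F" and r: "r > 0"
    and sub: "\<And>c. cmod c \<le> r \<Longrightarrow> x + c *\<^sub>C v \<in> S"
  shows "frechet_derivative F (at x) v = integral (cbox 0 1) (\<lambda>t. F (x + circ r t *\<^sub>C v) / circ r t)"
proof -
  define f where "f \<tau> = F (x + \<tau> *\<^sub>C v)" for \<tau>
  have df: "(f has_field_derivative frechet_derivative F (at (x + c *\<^sub>C v)) v) (at c)"
    if "cmod c \<le> r" for c
    unfolding f_def by (rule holo_on_complex_line[OF hol sub[OF that]])
  have "continuous_on (cball 0 r) f"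
    by (intro continuous_at_imp_continuous_on ballI DERIV_isCont[OF df]) simp
  moreover have "f holomorphic_on ball 0 r"
    unfolding holomorphic_on_def field_differentiable_def
    by (meson df has_field_derivative_at_within less_eq_real_def mem_ball_0)
  ultimately have "(f has_field_derivative
      (1 / (2 * of_real pi * \<i>) * contour_integral (circlepath 0 r) (\<lambda>u. f u / (u-0)^2))) (at 0)"
    using r by (intro Cauchy_derivative_integral_circlepath) auto
  then have "frechet_derivative F (at x) v =
      1 / (2 * of_real pi * \<i>) * contour_integral (circlepath 0 r) (\<lambda>u. f u / (u-0)^2)"
    using DERIV_unique df[of 0] r by fastforce
  also have "contour_integral (circlepath 0 r) (\<lambda>u. f u / (u-0)^2) =
      integral {0..1} (\<lambda>t. (2 * of_real pi * \<i>) * (f (circ r t) / circ r t))"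
    unfolding contour_integral_integral vector_derivative_circlepath
    using circ_nonzero[OF r]
    by (intro integral_cong) (simp add: circlepath circ_def power2_eq_square field_simps)
  also have "\<dots> = 2 * of_real pi * \<i> * integral {0..1} (\<lambda>t. f (circ r t) / circ r t)"
    by (rule integral_mult_right)
  finally show ?thesis by (simp add: f_def)
qed

lemma continuous_on_circle_integrand:
  fixes F :: "'a::complex_normed \<Rightarrow> complex"
  assumes "continuous_on S F" and r: "r > 0"
    and sub: "\<And>x c. x \<in> U \<Longrightarrow> cmod c \<le> r \<Longrightarrow> x + c *\<^sub>C v \<in> S"
  shows "continuous_on (U \<times> cbox 0 1) (\<lambda>(x, t). F (x + circ r t *\<^sub>C v) / circ r t)"
  unfolding split_beta
proof (intro continuous_intros continuous_on_compose2[OF assms(1)])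
  show "(\<lambda>x. fst x + circ r (snd x) *\<^sub>C v) ` (U \<times> cbox 0 1) \<subseteq> S"
    using sub norm_circ[of r] r by auto
qed (use circ_nonzero[OF r] in auto)

text \<open>Continuity of the derivative is not part of \<open>holo_on\<close>; it is read off the
  circle integral, whose integrand involves only values of \<open>F\<close>. Differentiating under
  the integral sign relies on it below.\<close>

lemma continuous_on_directional_derivative:
  fixes F :: "'a::complex_normed \<Rightarrow> complex"
  assumes hol: "holo_on S F" and S: "open S"
  shows "continuous_on S (\<lambda>x. frechet_derivative F (at x) v)"
proof (rule continuous_at_imp_continuous_on, rule)
  fix x0 assume "x0 \<in> S"
  with S obtain \<delta> r where *: "\<delta> > 0" "r > 0"
    "\<And>x c. x \<in> ball x0 \<delta> \<Longrightarrow> cmod c \<le> r \<Longrightarrow> x + c *\<^sub>C v \<in> S"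
    by (metis open_uniform_disc)
  have "continuous_on (ball x0 \<delta>) (\<lambda>x. integral (cbox 0 1) (\<lambda>t. F (x + circ r t *\<^sub>C v) / circ r t))"
    by (rule integral_continuous_on_param[OF
        continuous_on_circle_integrand[OF holo_on_imp_continuous_on[OF hol] *(2,3)]])
  then have "continuous_on (ball x0 \<delta>) (\<lambda>x. frechet_derivative F (at x) v)"
    by (rule continuous_on_eq) (simp add: frechet_derivative_integral_circle[OF hol *(2) *(3)])
  then show "isCont (\<lambda>x. frechet_derivative F (at x) v) x0"
    using * by (simp add: continuous_on_eq_continuous_at)
qed

text \<open>The circle integral is differentiated in its centre by the Leibniz rule, and complex
  linearity of the derivative of the integrand survives integration.\<close>

lemma holo_on_directional_derivative:
  fixes F :: "'a::{complex_normed,euclidean_space} \<Rightarrow> complex"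
  assumes hol: "holo_on S F" and S: "open S"
  shows "holo_on S (\<lambda>x. frechet_derivative F (at x) v)"
  unfolding holo_on_def
proof
  fix x0 assume "x0 \<in> S"
  with S obtain \<delta> r where *: "\<delta> > 0" "r > 0"
    "\<And>x c. x \<in> ball x0 \<delta> \<Longrightarrow> cmod c \<le> r \<Longrightarrow> x + c *\<^sub>C v \<in> S"
    by (metis open_uniform_disc)
  define U where "U = ball x0 \<delta>"
  define p where "p x t = x + circ r t *\<^sub>C v" for x t
  have pS: "p x t \<in> S" if "x \<in> U" for x t
    using *(2,3) norm_circ[of r t] that by (simp add: p_def U_def)
  \<comment> \<open>The Leibniz rule wants the derivative as a continuous family of bounded
    operators, hence the packaging as \<open>Blinfun\<close>.\<close>
  define fx where "fx x t = Blinfun (\<lambda>u. frechet_derivative F (at (p x t)) u / circ r t)" for x t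
  have bl: "bounded_linear (\<lambda>u. frechet_derivative F (at (p x t)) u / circ r t)" if "x \<in> U" for x t
    using holo_onD(1)[OF hol pS[OF that]] bounded_linear_divide has_derivative_bounded_linear
      bounded_linear_compose by blast
  have fx: "blinfun_apply (fx x t) u = frechet_derivative F (at (p x t)) u / circ r t"
    if "x \<in> U" for x t u
    unfolding fx_def using bounded_linear_Blinfun_apply[OF bl[OF that]] by simp
  have der: "((\<lambda>x. F (p x t) / circ r t) has_derivative blinfun_apply (fx x t)) (at x within U)"
    if "x \<in> U" for x t
  proof -
    have "((\<lambda>x. p x t) has_derivative (\<lambda>u. u)) (at x)"
      unfolding p_def by (auto intro!: derivative_eq_intros)
    from diff_chain_at[OF this holo_onD(1)[OF hol pS[OF that]]]
    have "((\<lambda>x. F (p x t)) has_derivative frechet_derivative F (at (p x t))) (at x)"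
      by (simp add: o_def)
    from bounded_linear.has_derivative[OF bounded_linear_divide this]
    have "((\<lambda>x. F (p x t) / circ r t) has_derivative
        (\<lambda>u. frechet_derivative F (at (p x t)) u / circ r t)) (at x)" .
    moreover have "blinfun_apply (fx x t) = (\<lambda>u. frechet_derivative F (at (p x t)) u / circ r t)"
      using fx[OF that] by blast
    ultimately show ?thesis using has_derivative_at_withinI by metis
  qed
  \<comment> \<open>In finite dimension, continuity in operator norm may be checked on basis
    vectors, where it is continuity of one directional derivative.\<close>
  have cont: "continuous_on (U \<times> cbox 0 1) (\<lambda>(x, t). fx x t)"
    unfolding split_beta
  proof (rule continuous_on_blinfun_componentwise)
    fix i :: 'a
    have "continuous_on (U \<times> cbox 0 1) (\<lambda>(x, t). frechet_derivative F (at (p x t)) i / circ r t)"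
      unfolding p_def
      by (rule continuous_on_circle_integrand[OF continuous_on_directional_derivative[OF hol S] *(2)])
        (use *(3) in \<open>auto simp: U_def\<close>)
    then show "continuous_on (U \<times> cbox 0 1) (\<lambda>x. blinfun_apply (fx (fst x) (snd x)) i)"
      by (rule continuous_on_eq) (auto simp: fx)
  qed
  have int: "(\<lambda>t. F (p x t) / circ r t) integrable_on cbox 0 1" if "x \<in> U" for x
  proof (rule integrable_continuous)
    have "continuous_on (U \<times> cbox 0 1) (\<lambda>(x, t). F (x + circ r t *\<^sub>C v) / circ r t)"
      by (rule continuous_on_circle_integrand[OF holo_on_imp_continuous_on[OF hol] *(2)])
        (use *(3) in \<open>auto simp: U_def\<close>)
    from continuous_on_compose2[OF this, of "cbox 0 1" "Pair x"]
    show "continuous_on (cbox 0 1) (\<lambda>t. F (p x t) / circ r t)"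
      using that by (simp add: p_def continuous_on_Pair image_subset_iff)
  qed
  have x0: "x0 \<in> U" using * by (simp add: U_def)
  let ?L = "integral (cbox 0 1) (fx x0)"
  have "((\<lambda>x. integral (cbox 0 1) (\<lambda>t. F (p x t) / circ r t)) has_derivative blinfun_apply ?L)
      (at x0 within U)"
    by (rule leibniz_rule[OF der int cont x0]) (auto simp: U_def)
  then have D: "((\<lambda>x. integral (cbox 0 1) (\<lambda>t. F (p x t) / circ r t)) has_derivative
      blinfun_apply ?L) (at x0)"
    using x0 at_within_open[of x0 U] by (simp add: U_def)
  have "((\<lambda>x. frechet_derivative F (at x) v) has_derivative blinfun_apply ?L) (at x0)"
    by (rule has_derivative_transform_within_open[OF D _ x0])
      (simp_all add: U_def p_def frechet_derivative_integral_circle[OF hol *(2) *(3)])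
  moreover have "blinfun_apply ?L (c *\<^sub>C u) = c *\<^sub>C blinfun_apply ?L u" for c u
  proof -
    have "continuous_on (cbox 0 1) (fx x0)"
      using continuous_on_compose2[OF cont, of "cbox 0 1" "Pair x0"] x0
      by (simp add: continuous_on_Pair image_subset_iff)
    then have fi: "fx x0 integrable_on cbox 0 1" by (rule integrable_continuous)
    have "integral (cbox 0 1) (\<lambda>t. blinfun_apply (fx x0 t) (c *\<^sub>C u)) =
        integral (cbox 0 1) (\<lambda>t. c * blinfun_apply (fx x0 t) u)"
      by (simp add: fx[OF x0] holo_onD(2)[OF hol pS[OF x0]] scaleC_complex_def)
    then show ?thesis
      by (simp only: blinfun_apply_integral[OF fi] scaleC_complex_def integral_mult_right)
  qed
  ultimately show "\<exists>D. ((\<lambda>x. frechet_derivative F (at x) v) has_derivative D) (at x0) \<and>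
      (\<forall>c u. D (c *\<^sub>C u) = c *\<^sub>C D u)" by blast
qed

section \<open>The scalar product and quotients of holomorphic functions\<close>

lemma cinner_add_left: "cinner (x + y) z = cinner x z + cinner y z"
  by (simp add: cinner_commute[of _ z] cinner_add_right)

lemma cinner_scaleC_left: "cinner (c *\<^sub>C x) y = cnj c * cinner x y"
  by (simp add: cinner_commute[of _ y] cinner_scaleC_right)

lemma cinner_zero_left [simp]: "cinner 0 x = 0"
  using cinner_scaleC_left[of 0 0 x] by simp

lemma cmod_cinner_le: "cmod (cinner x y) \<le> norm x * norm (y::'a::complex_hilbert)"
proof (cases "x = 0")
  case False
  define a N where "a = cinner x y" and "N = (norm x)\<^sup>2"
  have N: "N > 0" using False by (simp add: N_def)
  have xx: "cinner x x = of_real N" using norm_cinner[of x] by (simp only: N_def)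
  have yx: "cinner y x = cnj a" unfolding a_def by (rule cinner_commute)
  have aa: "a * cnj a = of_real ((cmod a)\<^sup>2)" by (simp add: complex_norm_square del: of_real_power)
  \<comment> \<open>This is \<open>N\<close> times the component of \<open>y\<close> orthogonal to
    \<open>x\<close>, scaled to avoid division; nonnegativity of its squared norm is the
    claim.\<close>
  define u where "u = of_real N *\<^sub>C y + (- a) *\<^sub>C x"
  have "cinner u u = of_real N * of_real N * cinner y y - of_real N * (a * cnj a)"
    unfolding u_def
    by (simp add: cinner_add_left cinner_add_right cinner_scaleC_left cinner_scaleC_right xx yx
        a_def[symmetric] algebra_simps)
  also have "\<dots> = of_real (N * (N * (norm y)\<^sup>2 - (cmod a)\<^sup>2))"
    unfolding aa norm_cinner[symmetric] by (simp add: algebra_simps)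
  finally have "(norm u)\<^sup>2 = N * (N * (norm y)\<^sup>2 - (cmod a)\<^sup>2)"
    unfolding norm_cinner[symmetric] by (simp only: of_real_eq_iff)
  then have "0 \<le> N * (N * (norm y)\<^sup>2 - (cmod a)\<^sup>2)"
    by (metis zero_le_power2)
  then have "(cmod a)\<^sup>2 \<le> (norm x * norm y)\<^sup>2"
    using N by (simp add: zero_le_mult_iff power_mult_distrib N_def)
  then show ?thesis
    unfolding a_def by (rule power2_le_imp_le) simp
qed simp

lemma bounded_bilinear_cinner:
  "bounded_bilinear (cinner :: 'a::complex_hilbert \<Rightarrow> 'a \<Rightarrow> complex)"
proof
  fix a b x y :: 'a and r :: real
  show "cinner (a + b) x = cinner a x + cinner b x" by (rule cinner_add_left)
  show "cinner a (x + y) = cinner a x + cinner a y" by (rule cinner_add_right)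
  show "cinner (r *\<^sub>R a) x = r *\<^sub>R cinner a x"
    by (simp add: scaleR_scaleC cinner_scaleC_left scaleC_complex_def)
  show "cinner a (r *\<^sub>R x) = r *\<^sub>R cinner a x"
    by (simp add: scaleR_scaleC cinner_scaleC_right scaleC_complex_def)
  show "\<exists>K. \<forall>a (b::'a). norm (cinner a b) \<le> norm a * norm b * K"
    by (intro exI[of _ 1]) (simp add: cmod_cinner_le)
qed

text \<open>The conjugate-linear derivative of \<open>f\<close> meets the antilinear slot of
  \<open>cinner\<close>, and the two conjugations cancel.\<close>

lemma holo_on_cinner:
  fixes f :: "'a::complex_normed \<Rightarrow> 'b::complex_hilbert"
  assumes "antiholo_on S f"
  shows "holo_on S (\<lambda>x. cinner (f x) w)"
  unfolding holo_on_def
proof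
  fix x assume "x \<in> S"
  then obtain D where D: "(f has_derivative D) (at x)" "\<forall>c v. D (c *\<^sub>C v) = cnj c *\<^sub>C D v"
    using assms by (auto simp: antiholo_on_def)
  show "\<exists>D. ((\<lambda>x. cinner (f x) w) has_derivative D) (at x) \<and> (\<forall>c v. D (c *\<^sub>C v) = c *\<^sub>C D v)"
    using bounded_linear.has_derivative[OF bounded_bilinear.bounded_linear_left[OF
      bounded_bilinear_cinner, of w] D(1)] D(2)
    by (intro exI[of _ "\<lambda>v. cinner (D v) w"]) (simp add: cinner_scaleC_left scaleC_complex_def)
qed

lemma holo_on_divide:
  fixes f g :: "'a::complex_normed \<Rightarrow> complex"
  assumes "holo_on S f" "holo_on S g" "\<And>x. x \<in> S \<Longrightarrow> g x \<noteq> 0"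
  shows "holo_on S (\<lambda>x. f x / g x)"
  unfolding holo_on_def
proof
  fix x assume x: "x \<in> S"
  obtain D where D: "(f has_derivative D) (at x)" "\<forall>c v. D (c *\<^sub>C v) = c *\<^sub>C D v"
    using assms(1) x by (auto simp: holo_on_def)
  obtain E where E: "(g has_derivative E) (at x)" "\<forall>c v. E (c *\<^sub>C v) = c *\<^sub>C E v"
    using assms(2) x by (auto simp: holo_on_def)
  show "\<exists>D. ((\<lambda>x. f x / g x) has_derivative D) (at x) \<and> (\<forall>c v. D (c *\<^sub>C v) = c *\<^sub>C D v)"
    using has_derivative_divide'[OF D(1) E(1) assms(3)[OF x]] D(2) E(2)
    by (intro exI[of _ "\<lambda>h. (D h * g x - f x * E h) / (g x * g x)"])
      (simp add: scaleC_complex_def algebra_simps)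
qed

section \<open>Partial derivatives and the chain rule in coordinates\<close>

lemma cpartial_eq:
  fixes f :: "complex ^ 'n::finite \<Rightarrow> complex"
  assumes "holo_on S f" "w \<in> S"
  shows "cpartial i f w = frechet_derivative f (at w) (axis i 1)"
proof -
  have "(\<lambda>t. f (w + axis i t)) = (\<lambda>t. f (w + t *\<^sub>C axis i 1))"
    by (intro ext arg_cong[of _ _ "\<lambda>v. f (w + v)"])
      (simp add: vec_eq_iff scaleC_vec_def scaleC_complex_def axis_def)
  then show ?thesis
    unfolding cpartial_def
    using DERIV_imp_deriv[OF holo_on_complex_line[OF assms(1), of w 0 "axis i 1"]] assms(2)
    by simp
qed

text \<open>The curve is given by components because the vector field will be computed one
  coordinate at a time. Complex linearity turns the derivative on \<open>axis i (q i)\<close> into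
  \<open>q i\<close> times a partial derivative.\<close>

lemma has_vector_derivative_holo_on_compose:
  fixes f :: "complex ^ 'n::finite \<Rightarrow> complex"
  assumes f: "holo_on S f" "c t \<in> S"
    and c: "\<And>i. ((\<lambda>t. c t $ i) has_vector_derivative q i) (at t)"
  shows "((\<lambda>t. f (c t)) has_vector_derivative (\<Sum>i\<in>UNIV. q i * cpartial i f (c t))) (at t)"
proof -
  let ?D = "frechet_derivative f (at (c t))"
  have ax: "bounded_linear (axis i :: complex \<Rightarrow> complex ^ 'n)" for i
    unfolding linear_conv_bounded_linear[symmetric]
    by (rule linearI) (simp_all add: vec_eq_iff axis_def)
  have "(\<lambda>t. \<Sum>i\<in>UNIV. axis i (c t $ i)) = c"
    by (simp add: fun_eq_iff vec_eq_iff axis_def if_distrib sum.delta cong: if_cong)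
  moreover have "((\<lambda>t. \<Sum>i\<in>UNIV. axis i (c t $ i)) has_vector_derivative
      (\<Sum>i\<in>UNIV. axis i (q i))) (at t)"
    by (intro has_vector_derivative_sum bounded_linear.has_vector_derivative[OF ax] c)
  ultimately have "(c has_vector_derivative (\<Sum>i\<in>UNIV. axis i (q i))) (at t)"
    by (simp only:)
  from vector_derivative_diff_chain_within[OF this has_derivative_at_withinI[OF holo_onD(1)[OF f]]]
  have "((\<lambda>t. f (c t)) has_vector_derivative ?D (\<Sum>i\<in>UNIV. axis i (q i))) (at t)"
    by (simp add: o_def)
  also have "?D (\<Sum>i\<in>UNIV. axis i (q i)) = (\<Sum>i\<in>UNIV. ?D (axis i (q i)))"
    by (intro linear_sum has_derivative_linear[OF holo_onD(1)[OF f]])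
  also have "\<dots> = (\<Sum>i\<in>UNIV. q i * cpartial i f (c t))"
  proof (rule sum.cong[OF refl])
    fix i
    have "axis i (q i) = q i *\<^sub>C (axis i 1 :: complex ^ 'n)"
      by (simp add: vec_eq_iff scaleC_vec_def scaleC_complex_def axis_def)
    then show "?D (axis i (q i)) = q i * cpartial i f (c t)"
      by (simp add: holo_onD(2)[OF f] cpartial_eq[OF f] scaleC_complex_def)
  qed
  finally show ?thesis .
qed

section \<open>Charts and curves\<close>

lemma smooth_on_imp_differentiable: "smooth_on S f \<Longrightarrow> x \<in> S \<Longrightarrow> f differentiable (at x)"
  unfolding smooth_on_def by (drule spec[of _ "Suc 0"]) simp

context
  fixes R :: "'e::real_normed_vector set \<Rightarrow> ('e \<Rightarrow> 'e) \<Rightarrow> bool"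
    and X :: "'a topology" and A :: "('a, 'e) chart set"
  assumes mfd: "manifold R X A"
begin

lemma manifold_chart_at:
  assumes "x \<in> topspace X" obtains U \<phi> where "(U, \<phi>) \<in> A" "x \<in> U"
proof -
  have "x \<in> \<Union> (fst ` A)" using mfd assms unfolding manifold_def by simp
  then show thesis using that by auto
qed

lemma chart_homeomorphic:
  "(U, \<phi>) \<in> A \<Longrightarrow> homeomorphic_map (subtopology X U) (top_of_set (\<phi> ` U)) \<phi>"
  using mfd unfolding manifold_def by auto

lemma chart_open: "(U, \<phi>) \<in> A \<Longrightarrow> openin X U" "(U, \<phi>) \<in> A \<Longrightarrow> open (\<phi> ` U)"
  using mfd unfolding manifold_def by auto

lemma chart_inj_on: "(U, \<phi>) \<in> A \<Longrightarrow> inj_on \<phi> U"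
  using chart_homeomorphic[of U \<phi>] chart_open(1)[of U \<phi>] openin_subset[of X U]
  by (simp add: homeomorphic_map_def topspace_subtopology_subset Int_absorb1)

lemma chart_inv_into [simp]: "(U, \<phi>) \<in> A \<Longrightarrow> x \<in> U \<Longrightarrow> inv_into U \<phi> (\<phi> x) = x"
  by (rule inv_into_f_f[OF chart_inj_on])

lemma chart_image_open:
  assumes "(U, \<phi>) \<in> A" "openin X W" shows "open (\<phi> ` (U \<inter> W))"
proof -
  have "openin (subtopology X U) (U \<inter> W)"
    using assms by (metis inf_commute openin_subtopology)
  then have "openin (top_of_set (\<phi> ` U)) (\<phi> ` (U \<inter> W))"
    using homeomorphic_map_openness_eq[OF chart_homeomorphic[OF assms(1)]] by blast
  then show ?thesis using chart_open(2)[OF assms(1)] openin_open_trans by blast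
qed

lemma manifold_fun_imp_continuous_map:
  assumes "manifold_fun R' A (topspace X) f" "\<And>S g. R' S g \<Longrightarrow> continuous_on S g"
  shows "continuous_map X euclidean f"
proof (rule pasting_lemma[where I = A and T = fst and f = "\<lambda>_. f"])
  fix c assume c: "c \<in> A"
  obtain U \<phi> where [simp]: "c = (U, \<phi>)" by fastforce
  have cA: "(U, \<phi>) \<in> A" using c by simp
  show "openin X (fst c)" using chart_open(1)[OF cA] by simp
  have "U \<inter> topspace X = U" using chart_open(1)[OF cA] openin_subset by blast
  then have "continuous_on (\<phi> ` U) (f \<circ> inv_into U \<phi>)"
    using assms cA unfolding manifold_fun_def by fastforce
  then have "continuous_map (top_of_set (\<phi> ` U)) euclidean (f \<circ> inv_into U \<phi>)" by simp
  from continuous_map_compose[OF homeomorphic_imp_continuous_map[OF chart_homeomorphic[OF cA]] this]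
  have "continuous_map (subtopology X U) euclidean ((f \<circ> inv_into U \<phi>) \<circ> \<phi>)" .
  from continuous_map_eq[OF this, of f]
  show "continuous_map (subtopology X (fst c)) euclidean f" using cA by simp
next
  fix x assume "x \<in> topspace X"
  then obtain U \<phi> where "(U, \<phi>) \<in> A" "x \<in> U" by (rule manifold_chart_at)
  then show "\<exists>j. j \<in> A \<and> x \<in> fst j \<and> f x = f x" by (intro exI[of _ "(U, \<phi>)"]) simp
qed simp

text \<open>The chart factorisation of \<open>f\<close> along the curve is valid only while the
  curve stays in \<open>U\<close>; continuity makes these times an open set, which suffices for a
  derivative.\<close>

lemma has_derivative_along_curve:
  fixes \<gamma> :: "real \<Rightarrow> 'a" and f :: "'a \<Rightarrow> 'f::real_normed_vector"
  assumes \<gamma>: "continuous_map euclidean X \<gamma>" and c: "(U, \<phi>) \<in> A" "\<gamma> t \<in> U"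
    and D: "((\<phi> \<circ> \<gamma>) has_derivative D) (at t)"
    and E: "((f \<circ> inv_into U \<phi>) has_derivative E) (at (\<phi> (\<gamma> t)))"
  shows "((f \<circ> \<gamma>) has_derivative (E \<circ> D)) (at t)"
proof -
  have "openin euclidean {s \<in> topspace euclidean. \<gamma> s \<in> U}"
    by (rule openin_continuous_map_preimage[OF \<gamma> chart_open(1)[OF c(1)]])
  then have "open {s. \<gamma> s \<in> U}" by simp
  moreover have "((f \<circ> inv_into U \<phi>) \<circ> (\<phi> \<circ> \<gamma>) has_derivative (E \<circ> D)) (at t)"
    by (rule diff_chain_at[OF D]) (use E in simp)
  ultimately show ?thesis
    by (elim has_derivative_transform_within_open) (use c in auto)
qed

end

lemma smooth_curve_differentiable:
  assumes "manifold_map smooth_on euclidean {(UNIV, \<lambda>t. t)} Y B \<gamma>" "(V, \<psi>) \<in> B" "\<gamma> (t::real) \<in> V"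
  shows "(\<psi> \<circ> \<gamma>) differentiable (at t)"
proof -
  have "inv_into UNIV (\<lambda>t::real. t) = (\<lambda>t. t)"
    using inv_id by (simp add: id_def)
  then have "smooth_on {s. \<gamma> s \<in> V} (\<psi> \<circ> \<gamma>)"
    using assms unfolding manifold_map_def by (auto simp: o_def)
  then show ?thesis using assms(3) by (auto intro: smooth_on_imp_differentiable)
qed

text \<open>Chain rule in charts: a complex-linear derivative after a conjugate-linear one is
  conjugate-linear.\<close>

lemma antiholo_on_compose_manifold_map:
  fixes f :: "'b \<Rightarrow> 'f::complex_normed" and A :: "('a, 'e::complex_normed) chart set"
    and B :: "('b, 'e) chart set"
  assumes X: "manifold R X A" and Y: "manifold R' Y B"
    and \<sigma>: "manifold_map antiholo_on X A Y B \<sigma>" and f: "manifold_fun holo_on B (topspace Y) f"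
  shows "manifold_fun antiholo_on A (topspace X) (f \<circ> \<sigma>)"
  unfolding manifold_fun_def antiholo_on_def
proof clarify
  fix U \<phi> x assume c: "(U, \<phi>) \<in> A" and x: "x \<in> U" "x \<in> topspace X"
  have cont: "continuous_map X Y \<sigma>" using \<sigma> by (simp add: manifold_map_def)
  then have "\<sigma> x \<in> topspace Y" using x(2) continuous_map_image_subset_topspace by fastforce
  then obtain V \<psi> where d: "(V, \<psi>) \<in> B" "\<sigma> x \<in> V" by (rule manifold_chart_at[OF Y])
  let ?S = "\<phi> ` {y \<in> U. \<sigma> y \<in> V}"
  have "{y \<in> U. \<sigma> y \<in> V} = U \<inter> {y \<in> topspace X. \<sigma> y \<in> V}"
    using chart_open(1)[OF X c] openin_subset by blast
  then have S: "open ?S"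
    using chart_image_open[OF X c openin_continuous_map_preimage[OF cont chart_open(1)[OF Y d(1)]]]
    by simp
  have "antiholo_on ?S (\<psi> \<circ> \<sigma> \<circ> inv_into U \<phi>)"
    using \<sigma> c d unfolding manifold_map_def by blast
  then obtain D where D: "((\<psi> \<circ> \<sigma> \<circ> inv_into U \<phi>) has_derivative D) (at (\<phi> x))"
      "\<forall>c v. D (c *\<^sub>C v) = cnj c *\<^sub>C D v"
    using x(1) d(2) unfolding antiholo_on_def by blast
  have "holo_on (\<psi> ` (V \<inter> topspace Y)) (f \<circ> inv_into V \<psi>)"
    using f d unfolding manifold_fun_def by blast
  then obtain E where E: "((f \<circ> inv_into V \<psi>) has_derivative E) (at (\<psi> (\<sigma> x)))"
      "\<forall>c v. E (c *\<^sub>C v) = c *\<^sub>C E v"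
    using d(2) \<open>\<sigma> x \<in> topspace Y\<close> unfolding holo_on_def by blast
  have "((f \<circ> inv_into V \<psi>) \<circ> (\<psi> \<circ> \<sigma> \<circ> inv_into U \<phi>) has_derivative (E \<circ> D)) (at (\<phi> x))"
    by (rule diff_chain_at[OF D(1)]) (use E(1) x(1) c X in simp)
  then have "((f \<circ> \<sigma>) \<circ> inv_into U \<phi> has_derivative (E \<circ> D)) (at (\<phi> x))"
    by (rule has_derivative_transform_within_open[OF _ S])
      (use x(1) d c X Y in auto)
  then show "\<exists>D. ((f \<circ> \<sigma>) \<circ> inv_into U \<phi> has_derivative D) (at (\<phi> x)) \<and>
      (\<forall>c v. D (c *\<^sub>C v) = cnj c *\<^sub>C D v)"
    using D(2) E(2) by (intro exI[of _ "E \<circ> D"]) simp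
qed

section \<open>Product charts and left translation\<close>

text \<open>An open set of the product topology contains a rectangle around each of its points, and
  charts of the factors send its sides to open sets.\<close>

lemma prod_chart_image_open:
  assumes "manifold R X A" "(U, \<phi>) \<in> A" "(V, \<psi>) \<in> A" "openin (prod_topology X X) W"
  shows "open (map_prod \<phi> \<psi> ` ((U \<times> V) \<inter> W))"
  unfolding open_prod_def
proof
  fix p assume "p \<in> map_prod \<phi> \<psi> ` ((U \<times> V) \<inter> W)"
  then obtain x y where xy: "x \<in> U" "y \<in> V" "(x, y) \<in> W" "p = (\<phi> x, \<psi> y)" by auto
  obtain S T where ST: "openin X S" "openin X T" "x \<in> S" "y \<in> T" "S \<times> T \<subseteq> W"
    using assms(4) xy(3) unfolding openin_prod_topology_alt by meson
  show "\<exists>S T. open S \<and> open T \<and> p \<in> S \<times> T \<and> S \<times> T \<subseteq> map_prod \<phi> \<psi> ` ((U \<times> V) \<inter> W)"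
  proof (intro exI conjI)
    show "open (\<phi> ` (U \<inter> S))" by (rule chart_image_open[OF assms(1,2) ST(1)])
    show "open (\<psi> ` (V \<inter> T))" by (rule chart_image_open[OF assms(1,3) ST(2)])
    show "p \<in> \<phi> ` (U \<inter> S) \<times> \<psi> ` (V \<inter> T)" using xy ST by simp
    show "\<phi> ` (U \<inter> S) \<times> \<psi> ` (V \<inter> T) \<subseteq> map_prod \<phi> \<psi> ` ((U \<times> V) \<inter> W)"
      using ST(5) by (force simp: image_iff)
  qed
qed

lemma inv_into_map_prod:
  assumes "inj_on \<phi> U" "inj_on \<psi> V" "x \<in> U" "y \<in> V"
  shows "inv_into (U \<times> V) (map_prod \<phi> \<psi>) (\<phi> x, \<psi> y) = (x, y)"
  using inv_into_f_f[OF map_prod_inj_on[OF assms(1,2)], of "(x, y)"] assms(3,4) by simp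

text \<open>In charts, \<open>\<zeta> (c t \<otimes> g)\<close> is a holomorphic function of two variables evaluated along a curve in
  the first one, so its derivative at \<open>t = 0\<close> is a directional derivative of that function.\<close>

lemma left_translation_derivative:
  fixes GC :: "('k, complex ^ 'd::finite) lie_group" and c :: "real \<Rightarrow> 'k" and \<zeta> :: "'k \<Rightarrow> complex"
  assumes GC: "complex_lie_group GC" and W: "openin (topo GC) W"
    and \<zeta>: "manifold_fun holo_on (atlas GC) W \<zeta>"
    and c: "continuous_map euclidean (topo GC) c" "c 0 = \<one>\<^bsub>GC\<^esub>"
    and U: "(U, \<phi>) \<in> atlas GC" "\<one>\<^bsub>GC\<^esub> \<in> U"
    and v: "((\<phi> \<circ> c) has_vector_derivative v) (at 0)"
  shows "g \<in> W \<Longrightarrow> (\<lambda>t. \<zeta> (c t \<otimes>\<^bsub>GC\<^esub> g)) differentiable (at 0)"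
    and "manifold_fun holo_on (atlas GC) W (\<lambda>g. vector_derivative (\<lambda>t. \<zeta> (c t \<otimes>\<^bsub>GC\<^esub> g)) (at 0))"
proof -
  interpret group GC using GC by (simp add: complex_lie_group_def)
  define X where "X = topo GC"
  have mfd: "manifold holo_on X (atlas GC)" and top: "topspace X = carrier GC"
    and mult: "manifold_map holo_on (prod_topology X X) (prod_atlas (atlas GC) (atlas GC))
      X (atlas GC) (\<lambda>(x, y). x \<otimes>\<^bsub>GC\<^esub> y)"
    using GC by (simp_all add: complex_lie_group_def X_def)
  have WC: "W \<subseteq> carrier GC" using W openin_subset top X_def by blast
  define m where "m = (\<lambda>(x, y). x \<otimes>\<^bsub>GC\<^esub> y)"
  have Wm: "openin (prod_topology X X) {p \<in> topspace (prod_topology X X). m p \<in> V \<inter> W}"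
    if "(V, \<psi>) \<in> atlas GC" for V \<psi>
    using mult chart_open(1)[OF mfd that] W unfolding manifold_map_def m_def X_def
    by (intro openin_continuous_map_preimage) auto
  \<comment> \<open>The same chart \<open>V\<close> serves for \<open>g\<close> and for the product:
    near the identity the product stays close to \<open>g\<close>. On \<open>S\<close> the product
    lies in \<open>V \<inter> W\<close>, where both the chart and \<open>\<zeta>\<close> can be
    used.\<close>
  define S where "S V \<psi> = map_prod \<phi> \<psi> ` ((U \<times> V) \<inter> {p \<in> topspace (prod_topology X X). m p \<in> V \<inter> W})"
    for V and \<psi> :: "'k \<Rightarrow> complex ^ 'd"
  define H where "H V \<psi> = \<zeta> \<circ> m \<circ> inv_into (U \<times> V) (map_prod \<phi> \<psi>)" for V and \<psi> :: "'k \<Rightarrow> complex ^ 'd"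
  have sub: "V \<subseteq> carrier GC" if "(V, \<psi>) \<in> atlas GC" for V \<psi>
    using chart_open(1)[OF mfd that] openin_subset top by blast
  have S: "open (S V \<psi>)" if "(V, \<psi>) \<in> atlas GC" for V \<psi>
    unfolding S_def by (rule prod_chart_image_open[OF mfd U(1) that Wm[OF that]])
  have inS: "(\<phi> \<one>\<^bsub>GC\<^esub>, \<psi> g) \<in> S V \<psi>" if "(V, \<psi>) \<in> atlas GC" "g \<in> V \<inter> W" for V \<psi> g
  proof -
    have "g \<in> carrier GC" using that(2) WC by blast
    then show ?thesis
      unfolding S_def using that U(2) top
      by (intro rev_image_eqI[of "(\<one>\<^bsub>GC\<^esub>, g)"]) (auto simp: m_def)
  qed
  have H: "holo_on (S V \<psi>) (H V \<psi>)" if V: "(V, \<psi>) \<in> atlas GC" for V \<psi>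
  proof -
    let ?i = "inv_into (U \<times> V) (map_prod \<phi> \<psi>)"
    have i: "?i (\<phi> x, \<psi> y) = (x, y)" if "x \<in> U" "y \<in> V" for x y
      by (rule inv_into_map_prod[OF chart_inj_on[OF mfd U(1)] chart_inj_on[OF mfd V] that])
    have "(U \<times> V, map_prod \<phi> \<psi>) \<in> prod_atlas (atlas GC) (atlas GC)"
      using U V unfolding prod_atlas_def by blast
    then have "holo_on (map_prod \<phi> \<psi> ` {p \<in> U \<times> V. m p \<in> V}) (\<psi> \<circ> m \<circ> ?i)"
      using mult V unfolding manifold_map_def m_def by blast
    then have 1: "holo_on (S V \<psi>) (\<psi> \<circ> m \<circ> ?i)"
      by (rule holo_on_subset) (auto simp: S_def)
    have 2: "holo_on (\<psi> ` (V \<inter> W)) (\<zeta> \<circ> inv_into V \<psi>)"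
      using \<zeta> V unfolding manifold_fun_def by blast
    have "holo_on (S V \<psi>) ((\<zeta> \<circ> inv_into V \<psi>) \<circ> (\<psi> \<circ> m \<circ> ?i))"
      by (rule holo_on_compose[OF 1 2]) (auto simp: S_def i)
    then show ?thesis
      by (rule holo_on_cong[OF _ S[OF V]]) (auto simp: S_def H_def i chart_inv_into[OF mfd V])
  qed
  \<comment> \<open>Only the first factor moves, so the direction is \<open>(v, 0)\<close>, which is
    independent of \<open>g\<close>.\<close>
  have deriv: "((\<lambda>t. \<zeta> (c t \<otimes>\<^bsub>GC\<^esub> g)) has_vector_derivative
      frechet_derivative (H V \<psi>) (at (\<phi> \<one>\<^bsub>GC\<^esub>, \<psi> g)) (v, 0)) (at 0)"
    if V: "(V, \<psi>) \<in> atlas GC" and g: "g \<in> V \<inter> W" for V \<psi> g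
  proof -
    have "((\<lambda>t. (\<phi> (c t), \<psi> g)) has_vector_derivative (v, 0)) (at 0)"
      using v by (intro has_vector_derivative_Pair has_vector_derivative_const) (simp add: o_def)
    from vector_derivative_diff_chain_within[OF this, of "H V \<psi>",
        OF has_derivative_at_withinI[OF holo_onD(1)[OF H[OF V]]]]
    have D: "((\<lambda>t. H V \<psi> (\<phi> (c t), \<psi> g)) has_vector_derivative
      frechet_derivative (H V \<psi>) (at (\<phi> \<one>\<^bsub>GC\<^esub>, \<psi> g)) (v, 0)) (at 0)"
      using inS[OF V g] by (simp add: o_def c(2))
    have "openin euclidean {t \<in> topspace euclidean. c t \<in> U}"
      by (rule openin_continuous_map_preimage[OF c(1)]) (use chart_open(1)[OF mfd U(1)] in \<open>simp add: X_def\<close>)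
    then have "open {t. c t \<in> U}" by simp
    then show ?thesis
      by (rule has_vector_derivative_transform_within_open[OF D])
        (use g U(2) c(2) in \<open>auto simp: H_def m_def
          inv_into_map_prod[OF chart_inj_on[OF mfd U(1)] chart_inj_on[OF mfd V]]\<close>)
  qed
  show "(\<lambda>t. \<zeta> (c t \<otimes>\<^bsub>GC\<^esub> g)) differentiable (at 0)" if g: "g \<in> W"
  proof -
    have "g \<in> topspace X" using g WC top by blast
    then obtain V \<psi> where "(V, \<psi>) \<in> atlas GC" "g \<in> V" by (rule manifold_chart_at[OF mfd])
    then show ?thesis using deriv[of V \<psi> g] g differentiableI_vector by blast
  qed
  show "manifold_fun holo_on (atlas GC) W (\<lambda>g. vector_derivative (\<lambda>t. \<zeta> (c t \<otimes>\<^bsub>GC\<^esub> g)) (at 0))"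
    unfolding manifold_fun_def
  proof clarify
    fix V \<psi> assume V: "(V, \<psi>) \<in> atlas GC"
    \<comment> \<open>Freezing the first variable at the identity is a holomorphic affine embedding;
      composing with it leaves a function of \<open>g\<close> alone.\<close>
    have "holo_on (\<psi> ` (V \<inter> W)) (Pair (\<phi> \<one>\<^bsub>GC\<^esub>))"
      unfolding holo_on_def
      by (intro ballI exI[of _ "\<lambda>u. (0, u)"] conjI)
        (auto intro!: derivative_eq_intros simp: scaleC_prod_def)
    from holo_on_compose[OF this holo_on_directional_derivative[OF H[OF V] S[OF V], of "(v, 0)"]]
    have "holo_on (\<psi> ` (V \<inter> W)) ((\<lambda>x. frechet_derivative (H V \<psi>) (at x) (v, 0)) \<circ> Pair (\<phi> \<one>\<^bsub>GC\<^esub>))"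
      using inS[OF V] by blast
    then show "holo_on (\<psi> ` (V \<inter> W))
        ((\<lambda>g. vector_derivative (\<lambda>t. \<zeta> (c t \<otimes>\<^bsub>GC\<^esub> g)) (at 0)) \<circ> inv_into V \<psi>)"
    proof (rule holo_on_cong)
      show "open (\<psi> ` (V \<inter> W))" using chart_image_open[OF mfd V] W by (simp add: X_def)
    next
      fix x assume "x \<in> \<psi> ` (V \<inter> W)"
      then obtain g where g: "x = \<psi> g" "g \<in> V \<inter> W" by blast
      then show "((\<lambda>x. frechet_derivative (H V \<psi>) (at x) (v, 0)) \<circ> Pair (\<phi> \<one>\<^bsub>GC\<^esub>)) x =
          ((\<lambda>g. vector_derivative (\<lambda>t. \<zeta> (c t \<otimes>\<^bsub>GC\<^esub> g)) (at 0)) \<circ> inv_into V \<psi>) x"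
        using vector_derivative_at[OF deriv[OF V g(2)]] chart_inv_into[OF mfd V, of g] by simp
    qed
  qed
qed

section \<open>Coherent state transforms\<close>

lemma topspace_quot_topology: "topspace (quot_topology Y p) = p ` topspace Y"
proof -
  have "openin (quot_topology Y p) (p ` topspace Y)"
    by (auto simp: openin_quot_topology intro: openin_subopen[THEN iffD2])
  then show ?thesis
    using openin_quot_topology[of Y p "topspace (quot_topology Y p)"] openin_subset by blast
qed

locale coherent_state_setting =
  fixes G :: "('g, real ^ 'd::finite) lie_group"
    and GC :: "('k, complex ^ 'd) lie_group"
    and \<iota> :: "'g \<Rightarrow> 'k" and \<sigma> :: "'k \<Rightarrow> 'k"
    and T :: "'g \<Rightarrow> 'h \<Rightarrow> 'h::complex_hilbert"
    and D :: "'h set" and TC :: "'k \<Rightarrow> 'h \<Rightarrow> 'h"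
    and e0 :: 'h and B :: "'k set"
    and X :: "'n::finite \<Rightarrow> complex ^ 'd" and z :: "'k set \<Rightarrow> complex ^ 'n"
    and M V :: "'k set set"
  assumes complexification: "complexification G GC \<iota> \<sigma>"
    and unitary: "unitary_rep G T"
    and e0_smooth: "e0 \<in> smooth_vectors G T"
    and extension: "holomorphic_extension G GC \<iota> T D TC"
    and e0_D: "e0 \<in> D" and e0_nonzero: "e0 \<noteq> 0"
    and embedding: "cs_homogeneous_embedding G GC \<iota> \<sigma> T TC e0 B"
    and coords: "coherent_coordinates G GC \<sigma> T TC e0 B V X z"
    and M_eq: "M = cs_manifold G GC \<iota> B"
    and V_eq: "V = cs_domain GC \<sigma> TC e0 B M"
begin

sublocale G: group G
  using complexification by (simp add: complexification_def real_lie_group_def)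

sublocale GC: group GC
  using complexification by (simp add: complexification_def complex_lie_group_def)

lemma GC_lie: "complex_lie_group GC"
  using complexification by (simp add: complexification_def)

lemma G_manifold: "manifold smooth_on (topo G) (atlas G)" "topspace (topo G) = carrier G"
  using complexification by (simp_all add: complexification_def real_lie_group_def)

lemma GC_manifold: "manifold holo_on (topo GC) (atlas GC)" "topspace (topo GC) = carrier GC"
  using GC_lie by (simp_all add: complex_lie_group_def)

lemma GC_mult_continuous:
  "continuous_map (prod_topology (topo GC) (topo GC)) (topo GC) (\<lambda>(x, y). x \<otimes>\<^bsub>GC\<^esub> y)"
  using GC_lie by (simp add: complex_lie_group_def manifold_map_def)

lemma \<iota>_hom: "\<iota> \<in> hom G GC" and \<sigma>_hom: "\<sigma> \<in> hom GC GC"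
  and \<iota>_smooth: "manifold_map smooth_on (topo G) (atlas G) (topo GC) (atlas GC) \<iota>"
  and \<sigma>_antiholo: "manifold_map antiholo_on (topo GC) (atlas GC) (topo GC) (atlas GC) \<sigma>"
  and \<sigma>_\<iota>: "g \<in> carrier G \<Longrightarrow> \<sigma> (\<iota> g) = \<iota> g"
  using complexification by (simp_all add: complexification_def)

lemma \<iota>_carrier [simp]: "g \<in> carrier G \<Longrightarrow> \<iota> g \<in> carrier GC"
  by (rule hom_in_carrier[OF \<iota>_hom])

lemma \<sigma>_carrier [simp]: "g \<in> carrier GC \<Longrightarrow> \<sigma> g \<in> carrier GC"
  by (rule hom_in_carrier[OF \<sigma>_hom])

lemma B_subgroup: "subgroup B GC"
  using embedding by (simp add: cs_homogeneous_embedding_def)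

lemma B_carrier: "b \<in> B \<Longrightarrow> b \<in> carrier GC"
  by (rule subgroup.mem_carrier[OF B_subgroup])

lemma TC_D: "g \<in> carrier GC \<Longrightarrow> v \<in> D \<Longrightarrow> TC g v \<in> D"
  using extension by (simp add: holomorphic_extension_def image_subset_iff)

lemma TC_scaleC: "g \<in> carrier GC \<Longrightarrow> v \<in> D \<Longrightarrow> TC g (c *\<^sub>C v) = c *\<^sub>C TC g v"
  using extension by (simp add: holomorphic_extension_def clinear_on_def)

lemma TC_mult:
  "g \<in> carrier GC \<Longrightarrow> h \<in> carrier GC \<Longrightarrow> v \<in> D \<Longrightarrow> TC (g \<otimes>\<^bsub>GC\<^esub> h) v = TC g (TC h v)"
  using extension by (simp add: holomorphic_extension_def image_subset_iff)

lemma TC_\<iota>: "g \<in> carrier G \<Longrightarrow> v \<in> D \<Longrightarrow> TC (\<iota> g) v = T g v"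
  using extension by (simp add: holomorphic_extension_def image_subset_iff)

text \<open>\<open>holomorphic_extension\<close> fixes \<open>TC\<close> at the identity only
  through \<open>G\<close>: \<open>\<iota>\<close> preserves the identity and \<open>T\<close> is
  trivial there.\<close>

lemma TC_one: "v \<in> D \<Longrightarrow> TC \<one>\<^bsub>GC\<^esub> v = v"
  using TC_\<iota>[of "\<one>\<^bsub>G\<^esub>" v] hom_one[OF \<iota>_hom G.is_group GC.is_group] unitary
  by (simp add: unitary_rep_def)

section \<open>Matrix coefficients on the complex group\<close>

text \<open>This is the section of the homogeneous line bundle attached to \<open>\<psi>\<close>.
  Composition with \<open>\<sigma>\<close> compensates the antilinear slot and makes it
  holomorphic.\<close>

definition rep_fun :: "'h \<Rightarrow> 'k \<Rightarrow> complex"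
  where "rep_fun \<psi> g = cinner (TC (\<sigma> g) e0) \<psi>"

lemma rep_fun_antiholo:
  "manifold_fun antiholo_on (atlas GC) (carrier GC) ((\<lambda>g. TC g e0) \<circ> \<sigma>)"
  using antiholo_on_compose_manifold_map[OF GC_manifold(1) GC_manifold(1) \<sigma>_antiholo, of "\<lambda>g. TC g e0"]
    extension e0_D unfolding GC_manifold(2) holomorphic_extension_def by blast

lemma rep_fun_holo: "manifold_fun holo_on (atlas GC) (carrier GC) (rep_fun \<psi>)"
  unfolding manifold_fun_def
proof clarify
  fix U \<phi> assume "(U, \<phi>) \<in> atlas GC"
  then have "antiholo_on (\<phi> ` (U \<inter> carrier GC)) ((\<lambda>g. TC g e0) \<circ> \<sigma> \<circ> inv_into U \<phi>)"
    using rep_fun_antiholo unfolding manifold_fun_def by blast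
  from holo_on_cinner[OF this, of \<psi>]
  show "holo_on (\<phi> ` (U \<inter> carrier GC)) (rep_fun \<psi> \<circ> inv_into U \<phi>)"
    by (simp add: rep_fun_def o_def)
qed

lemma rep_fun_continuous: "continuous_map (topo GC) euclidean (rep_fun \<psi>)"
  using manifold_fun_imp_continuous_map[OF GC_manifold(1), of holo_on "rep_fun \<psi>"] rep_fun_holo
    holo_on_imp_continuous_on unfolding GC_manifold(2) by blast

text \<open>Elements of \<open>B\<close> change the coefficient by the factor \<open>cnj c\<close>.
  It cannot vanish, since the inverse element must recover \<open>e0\<close>; thus nonvanishing is a
  property of cosets.\<close>

lemma rep_fun_nonzero_coset:
  assumes g: "g \<in> carrier GC" and b: "b \<in> B" and nz: "rep_fun e0 g \<noteq> 0"
  shows "rep_fun e0 (g \<otimes>\<^bsub>GC\<^esub> b) \<noteq> 0"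
proof -
  have bC: "b \<in> carrier GC" by (rule B_carrier[OF b])
  obtain c where c: "TC (\<sigma> b) e0 = c *\<^sub>C e0"
    using embedding b by (auto simp: cs_homogeneous_embedding_def cline_def)
  have "TC (\<sigma> (inv\<^bsub>GC\<^esub> b)) (TC (\<sigma> b) e0) = TC (\<sigma> (inv\<^bsub>GC\<^esub> b \<otimes>\<^bsub>GC\<^esub> b)) e0"
    using bC e0_D by (subst hom_mult[OF \<sigma>_hom]) (simp_all add: TC_mult)
  also have "\<dots> = e0"
    using bC hom_one[OF \<sigma>_hom GC.is_group GC.is_group] TC_one[OF e0_D] by simp
  finally have "c *\<^sub>C TC (\<sigma> (inv\<^bsub>GC\<^esub> b)) e0 = e0"
    using bC e0_D by (simp add: c TC_scaleC)
  then have "c \<noteq> 0" using e0_nonzero by auto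
  moreover have "rep_fun e0 (g \<otimes>\<^bsub>GC\<^esub> b) = cnj c * rep_fun e0 g"
    using g bC e0_D by (simp add: rep_fun_def hom_mult[OF \<sigma>_hom] TC_mult c TC_scaleC cinner_scaleC_left)
  ultimately show ?thesis using nz by simp
qed

text \<open>The embedding sends \<open>gH\<close> to \<open>\<iota>(g)B\<close>, because its value is a single coset containing \<open>\<iota>(g)\<close>.\<close>

lemma M_open: "openin (coset_space GC B) M"
proof -
  define H where "H = line_stabilizer G T e0"
  define j where "j = (\<lambda>C. \<iota> ` C <#>\<^bsub>GC\<^esub> B)"
  have emb: "embedding_map (coset_space G H) (coset_space GC B) j"
    and op: "open_map (coset_space G H) (coset_space GC B) j"
    using embedding unfolding cs_homogeneous_embedding_def Let_def H_def j_def by blast+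
  have "\<one>\<^bsub>G\<^esub> \<in> H"
    using unitary by (auto simp: H_def line_stabilizer_def unitary_rep_def cline_def intro!: exI[of _ 1])
  have j: "j (g <#\<^bsub>G\<^esub> H) = \<iota> g <#\<^bsub>GC\<^esub> B" if g: "g \<in> carrier G" for g
  proof -
    \<comment> \<open>A priori the set product is a union of cosets. Points of the target quotient
      are single cosets, so that \<open>j\<close> maps into the target already excludes a larger
      union.\<close>
    have "j (g <#\<^bsub>G\<^esub> H) \<in> topspace (coset_space GC B)"
    proof -
      have "continuous_map (coset_space G H) (coset_space GC B) j"
        using homeomorphic_imp_continuous_map emb unfolding embedding_map_def
        by (metis continuous_map_in_subtopology)
      moreover have "g <#\<^bsub>G\<^esub> H \<in> topspace (coset_space G H)"
        using g G_manifold(2) by (simp add: coset_space_def topspace_quot_topology)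
      ultimately show ?thesis
        using continuous_map_image_subset_topspace by blast
    qed
    then obtain k where k: "k \<in> carrier GC" "j (g <#\<^bsub>G\<^esub> H) = k <#\<^bsub>GC\<^esub> B"
      unfolding coset_space_def topspace_quot_topology GC_manifold(2) by blast
    have "g \<in> g <#\<^bsub>G\<^esub> H"
      using \<open>\<one>\<^bsub>G\<^esub> \<in> H\<close> g by (force simp: l_coset_def)
    then have "\<iota> g \<in> j (g <#\<^bsub>G\<^esub> H)"
      using subgroup.one_closed[OF B_subgroup] g
      unfolding j_def set_mult_def by (force intro!: bexI[of _ "\<iota> g"] bexI[of _ "\<one>\<^bsub>GC\<^esub>"])
    then show ?thesis
      using GC.l_repr_independence[OF _ k(1) B_subgroup] k(2) by simp
  qed
  have "M = j ` topspace (coset_space G H)"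
    unfolding M_eq cs_manifold_def coset_space_def topspace_quot_topology G_manifold(2) using j by force
  then show ?thesis using op unfolding open_map_def by auto
qed

section \<open>The coordinate domain and its preimage\<close>

lemma coset_in_M_open: "openin (topo GC) {g \<in> carrier GC. g <#\<^bsub>GC\<^esub> B \<in> M}"
  using M_open unfolding coset_space_def openin_quot_topology GC_manifold(2) by blast

text \<open>The union of the cosets in \<open>V\<close> is the preimage of \<open>V\<close> in
  \<open>GC\<close>. \<open>cs_domain\<close> tests only one representative, so the forward
  inclusion needs that nonvanishing depends on the coset alone.\<close>

lemma Union_V: "\<Union> V = {g \<in> carrier GC. g <#\<^bsub>GC\<^esub> B \<in> M \<and> rep_fun e0 g \<noteq> 0}"
proof (intro equalityI subsetI)
  fix x assume "x \<in> \<Union> V"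
  then obtain g where g: "g \<in> carrier GC" "g <#\<^bsub>GC\<^esub> B \<in> M" "rep_fun e0 g \<noteq> 0" "x \<in> g <#\<^bsub>GC\<^esub> B"
    unfolding V_eq cs_domain_def rep_fun_def by blast
  obtain b where b: "b \<in> B" "x = g \<otimes>\<^bsub>GC\<^esub> b" using g(4) unfolding l_coset_def by blast
  show "x \<in> {g \<in> carrier GC. g <#\<^bsub>GC\<^esub> B \<in> M \<and> rep_fun e0 g \<noteq> 0}"
    using g b rep_fun_nonzero_coset[OF g(1) b(1) g(3)] B_carrier[OF b(1)]
      GC.l_repr_independence[OF g(4) g(1) B_subgroup] by auto
next
  fix x assume "x \<in> {g \<in> carrier GC. g <#\<^bsub>GC\<^esub> B \<in> M \<and> rep_fun e0 g \<noteq> 0}"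
  then show "x \<in> \<Union> V"
    using GC.lcos_self[OF _ B_subgroup, of x] unfolding V_eq cs_domain_def rep_fun_def by blast
qed

lemma coset_in_V:
  assumes "g \<in> \<Union> V" shows "g <#\<^bsub>GC\<^esub> B \<in> V"
  using assms unfolding Union_V unfolding V_eq cs_domain_def rep_fun_def by blast

lemma V_coset:
  assumes "C \<in> V" obtains g where "g \<in> \<Union> V" "C = g <#\<^bsub>GC\<^esub> B"
  using assms unfolding Union_V unfolding V_eq cs_domain_def rep_fun_def by blast

lemma Union_V_open: "openin (topo GC) (\<Union> V)"
proof -
  have "openin (topo GC) {g \<in> topspace (topo GC). rep_fun e0 g \<in> - {0}}"
    by (rule openin_continuous_map_preimage[OF rep_fun_continuous])
      (simp add: open_Compl)
  from openin_Int[OF coset_in_M_open this] show ?thesis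
    unfolding Union_V GC_manifold(2) by (rule back_subst[of "openin (topo GC)"]) auto
qed

lemma Union_V_carrier: "g \<in> \<Union> V \<Longrightarrow> g \<in> carrier GC"
  by (simp add: Union_V)

lemma V_open: "openin (coset_space GC B) V"
proof -
  have "{g \<in> carrier GC. g <#\<^bsub>GC\<^esub> B \<in> V} = \<Union> V"
  proof (intro equalityI subsetI)
    fix g assume "g \<in> {g \<in> carrier GC. g <#\<^bsub>GC\<^esub> B \<in> V}"
    then show "g \<in> \<Union> V" using GC.lcos_self[OF _ B_subgroup, of g] by blast
  qed (use coset_in_V Union_V_carrier in blast)
  moreover have "V \<subseteq> (\<lambda>g. g <#\<^bsub>GC\<^esub> B) ` carrier GC" unfolding V_eq cs_domain_def by blast
  ultimately show ?thesis
    using Union_V_open unfolding coset_space_def openin_quot_topology GC_manifold(2) by simp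
qed

lemma z_image_open: "open (z ` V)"
  and z_inj_on: "inj_on z V"
  and holo_on_coordinates_iff: "coset_holo GC B V f \<longleftrightarrow> holo_on (z ` V) (f \<circ> inv_into V z)"
proof -
  have c: "holomorphic_coordinates GC B V z"
    using coords unfolding coherent_coordinates_def by blast
  then show "open (z ` V)" unfolding holomorphic_coordinates_def by blast
  show "inj_on z V"
    using c V_open openin_subset[of "coset_space GC B" V]
    by (simp add: holomorphic_coordinates_def homeomorphic_map_def topspace_subtopology_subset
        Int_absorb1)
  show "coset_holo GC B V f \<longleftrightarrow> holo_on (z ` V) (f \<circ> inv_into V z)"
    using c V_open unfolding holomorphic_coordinates_def by blast
qed

text \<open>Holomorphy on the quotient is defined by pullback to \<open>GC\<close>, so a function of
  the coordinates may be checked upstairs, where the chart calculus is available.\<close>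

lemma holo_on_coordinates:
  fixes f :: "complex ^ 'n \<Rightarrow> complex"
  assumes "manifold_fun holo_on (atlas GC) (\<Union> V) F"
    and "\<And>g. g \<in> \<Union> V \<Longrightarrow> F g = f (z (g <#\<^bsub>GC\<^esub> B))"
  shows "holo_on (z ` V) f"
proof -
  have "coset_holo GC B V (f \<circ> z)"
    unfolding coset_holo_def manifold_fun_def
  proof clarify
    fix U \<phi> assume U: "(U, \<phi>) \<in> atlas GC"
    then have "holo_on (\<phi> ` (U \<inter> \<Union> V)) (F \<circ> inv_into U \<phi>)"
      using assms(1) unfolding manifold_fun_def by blast
    then show "holo_on (\<phi> ` (U \<inter> \<Union> V)) ((\<lambda>g. (f \<circ> z) (g <#\<^bsub>GC\<^esub> B)) \<circ> inv_into U \<phi>)"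
    proof (rule holo_on_cong)
      show "open (\<phi> ` (U \<inter> \<Union> V))" by (rule chart_image_open[OF GC_manifold(1) U Union_V_open])
    next
      fix x assume "x \<in> \<phi> ` (U \<inter> \<Union> V)"
      then obtain g where "x = \<phi> g" "g \<in> U" "g \<in> \<Union> V" by blast
      then show "(F \<circ> inv_into U \<phi>) x = ((\<lambda>g. (f \<circ> z) (g <#\<^bsub>GC\<^esub> B)) \<circ> inv_into U \<phi>) x"
        using chart_inv_into[OF GC_manifold(1) U] assms(2) by simp
    qed
  qed
  then have "holo_on (z ` V) (f \<circ> z \<circ> inv_into V z)" by (simp add: holo_on_coordinates_iff)
  then show ?thesis
    by (rule holo_on_cong[OF _ z_image_open]) (simp add: f_inv_into_f)
qed

text \<open>The converse direction of the coordinate equivalence, applied to the projections of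
  \<open>z\<close>.\<close>

lemma coordinate_holo: "manifold_fun holo_on (atlas GC) (\<Union> V) (\<lambda>g. z (g <#\<^bsub>GC\<^esub> B) $ i)"
proof -
  have "bounded_linear (\<lambda>w :: complex ^ 'n. w $ i)" by (rule bounded_linear_vec_nth)
  then have "holo_on (z ` V) (\<lambda>w. w $ i)"
    unfolding holo_on_def
    by (intro ballI exI[of _ "\<lambda>w. w $ i"])
      (auto intro: bounded_linear_imp_has_derivative simp: scaleC_vec_def)
  then have "holo_on (z ` V) ((\<lambda>C. z C $ i) \<circ> inv_into V z)"
    by (rule holo_on_cong[OF _ z_image_open]) (simp add: f_inv_into_f)
  then show ?thesis
    unfolding holo_on_coordinates_iff[symmetric] coset_holo_def .
qed

section \<open>The transform as a quotient of matrix coefficients\<close>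

abbreviation transform :: "'h \<Rightarrow> complex ^ 'n \<Rightarrow> complex"
  where "transform \<equiv> cs_transform G T e0 X"

lemma coherent_state_eq:
  assumes "g \<in> \<Union> V"
  shows "coherent_state G T e0 X (z (g <#\<^bsub>GC\<^esub> B)) = (1 / cinner e0 (TC (\<sigma> g) e0)) *\<^sub>C TC (\<sigma> g) e0"
  using coords assms unfolding coherent_coordinates_def coherent_state_def by (metis sums_unique)

text \<open>Conjugation in the first slot turns the normalising factor of the coherent state into
  the reciprocal of \<open>rep_fun e0 g\<close>.\<close>

lemma transform_eq:
  assumes "g \<in> \<Union> V"
  shows "transform \<psi> (z (g <#\<^bsub>GC\<^esub> B)) = rep_fun \<psi> g / rep_fun e0 g"
  by (simp add: cs_transform_def coherent_state_eq[OF assms] cinner_scaleC_left rep_fun_def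
      cinner_commute[of e0 "TC (\<sigma> g) e0"])

lemma transform_holo: "holo_on (z ` V) (transform \<psi>)"
proof (rule holo_on_coordinates)
  show "manifold_fun holo_on (atlas GC) (\<Union> V) (\<lambda>g. rep_fun \<psi> g / rep_fun e0 g)"
    unfolding manifold_fun_def
  proof clarify
    fix U \<phi> assume U: "(U, \<phi>) \<in> atlas GC"
    have *: "holo_on (\<phi> ` (U \<inter> \<Union> V)) (rep_fun \<psi> \<circ> inv_into U \<phi>)" for \<psi>
      using rep_fun_holo U Union_V_carrier unfolding manifold_fun_def
      by (blast intro: holo_on_subset)
    have "(rep_fun e0 \<circ> inv_into U \<phi>) x \<noteq> 0" if "x \<in> \<phi> ` (U \<inter> \<Union> V)" for x
      using that chart_inv_into[OF GC_manifold(1) U] unfolding Union_V by auto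
    from holo_on_divide[OF *[of \<psi>] *[of e0] this]
    show "holo_on (\<phi> ` (U \<inter> \<Union> V)) ((\<lambda>g. rep_fun \<psi> g / rep_fun e0 g) \<circ> inv_into U \<phi>)"
      by (simp add: o_def)
  qed
qed (simp add: transform_eq)

section \<open>One-parameter subgroups and the derived representation\<close>

lemma exp_curve_one_param:
  assumes "Y \<in> lie_algebra G" shows "one_param_subgroup G (exp_curve G Y)"
proof -
  have "\<exists>\<gamma>. one_param_subgroup G \<gamma> \<and> velocity G \<gamma> = Y" using assms by (auto simp: lie_algebra_def)
  from someI_ex[OF this] show ?thesis by (simp add: exp_curve_def)
qed

lemma exp_curve_smooth:
  assumes "Y \<in> lie_algebra G"
  shows "manifold_map smooth_on euclidean {(UNIV, \<lambda>t. t)} (topo G) (atlas G) (exp_curve G Y)"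
  using exp_curve_one_param[OF assms] by (simp add: one_param_subgroup_def)

lemma exp_curve_continuous:
  assumes "Y \<in> lie_algebra G" shows "continuous_map euclidean (topo G) (exp_curve G Y)"
  using exp_curve_smooth[OF assms] by (simp add: manifold_map_def)

lemma exp_curve_carrier:
  assumes "Y \<in> lie_algebra G" shows "exp_curve G Y t \<in> carrier G"
  using continuous_map_image_subset_topspace[OF exp_curve_continuous[OF assms]] G_manifold(2) by auto

lemma exp_curve_zero:
  assumes "Y \<in> lie_algebra G" shows "exp_curve G Y 0 = \<one>\<^bsub>G\<^esub>"
proof -
  have "exp_curve G Y (0 + 0) = exp_curve G Y 0 \<otimes>\<^bsub>G\<^esub> exp_curve G Y 0"
    using exp_curve_one_param[OF assms] unfolding one_param_subgroup_def by blast
  then show ?thesis using exp_curve_carrier[OF assms] G.l_cancel_one[of "exp_curve G Y 0"] by simp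
qed

lemma exp_curve_minus:
  assumes "Y \<in> lie_algebra G" shows "exp_curve G Y (- t) \<otimes>\<^bsub>G\<^esub> exp_curve G Y t = \<one>\<^bsub>G\<^esub>"
proof -
  have "exp_curve G Y (- t + t) = exp_curve G Y (- t) \<otimes>\<^bsub>G\<^esub> exp_curve G Y t"
    using exp_curve_one_param[OF assms] unfolding one_param_subgroup_def by blast
  then show ?thesis using exp_curve_zero[OF assms] by simp
qed

text \<open>\<open>dT\<close> is defined through the total operator
  \<open>vector_derivative\<close>; smoothness of \<open>\<psi>\<close>, combined with that of the
  curve in a chart, shows that the limit exists.\<close>

lemma dT_has_vector_derivative:
  assumes Y: "Y \<in> lie_algebra G" and \<psi>: "\<psi> \<in> smooth_vectors G T"
  shows "((\<lambda>t. T (exp_curve G Y t) \<psi>) has_vector_derivative dT G T Y \<psi>) (at 0)"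
proof -
  have 1: "\<one>\<^bsub>G\<^esub> \<in> topspace (topo G)" by (simp add: G_manifold(2))
  obtain U \<phi> where U: "(U, \<phi>) \<in> atlas G" "\<one>\<^bsub>G\<^esub> \<in> U" by (rule manifold_chart_at[OF G_manifold(1) 1])
  obtain A where A: "((\<phi> \<circ> exp_curve G Y) has_derivative A) (at 0)"
    using smooth_curve_differentiable[OF exp_curve_smooth[OF Y] U(1), of 0] U(2)
    unfolding exp_curve_zero[OF Y] differentiable_def by blast
  have "smooth_on (\<phi> ` (U \<inter> carrier G)) ((\<lambda>g. T g \<psi>) \<circ> inv_into U \<phi>)"
    using \<psi> U(1) unfolding smooth_vectors_def manifold_fun_def by blast
  then obtain E where E: "((\<lambda>g. T g \<psi>) \<circ> inv_into U \<phi> has_derivative E) (at (\<phi> (exp_curve G Y 0)))"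
    using smooth_on_imp_differentiable U(2) unfolding exp_curve_zero[OF Y] differentiable_def by blast
  have "((\<lambda>g. T g \<psi>) \<circ> exp_curve G Y has_derivative E \<circ> A) (at 0)"
    by (rule has_derivative_along_curve[OF G_manifold(1) exp_curve_continuous[OF Y] U(1) _ A E])
      (simp add: U(2) exp_curve_zero[OF Y])
  then have "(\<lambda>t. T (exp_curve G Y t) \<psi>) differentiable (at 0)"
    by (auto simp: differentiable_def o_def)
  then show ?thesis unfolding dT_def by (simp only: vector_derivative_works)
qed

text \<open>The sign comes from unitarity: the adjoint of \<open>T\<close> at exp(tY) is
  \<open>T\<close> at exp(-tY).\<close>

definition translation :: "real ^ 'd \<Rightarrow> real \<Rightarrow> 'k"
  where "translation Y t = \<iota> (exp_curve G Y (- t))"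

lemma translation_carrier: "Y \<in> lie_algebra G \<Longrightarrow> translation Y t \<in> carrier GC"
  by (simp add: translation_def exp_curve_carrier)

lemma translation_zero: "Y \<in> lie_algebra G \<Longrightarrow> translation Y 0 = \<one>\<^bsub>GC\<^esub>"
  by (simp add: translation_def exp_curve_zero hom_one[OF \<iota>_hom G.is_group GC.is_group])

lemma exp_curve_reverse_continuous:
  assumes "Y \<in> lie_algebra G"
  shows "continuous_map euclidean (topo G) (\<lambda>t. exp_curve G Y (- t))"
proof -
  have "continuous_map euclidean euclidean (\<lambda>t::real. - t)"
    by (simp add: continuous_on_minus)
  from continuous_map_compose[OF this exp_curve_continuous[OF assms]] show ?thesis
    by (simp add: o_def)
qed

lemma translation_continuous:
  assumes "Y \<in> lie_algebra G" shows "continuous_map euclidean (topo GC) (translation Y)"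
proof -
  have "continuous_map (topo G) (topo GC) \<iota>" using \<iota>_smooth by (simp add: manifold_map_def)
  from continuous_map_compose[OF exp_curve_reverse_continuous[OF assms] this] show ?thesis
    by (simp add: o_def translation_def[abs_def])
qed

lemma translation_differentiable:
  assumes Y: "Y \<in> lie_algebra G" and U: "(U, \<phi>) \<in> atlas GC" "\<one>\<^bsub>GC\<^esub> \<in> U"
  obtains v where "((\<phi> \<circ> translation Y) has_vector_derivative v) (at 0)"
proof -
  have 1: "\<one>\<^bsub>G\<^esub> \<in> topspace (topo G)" by (simp add: G_manifold(2))
  obtain W \<psi> where W: "(W, \<psi>) \<in> atlas G" "\<one>\<^bsub>G\<^esub> \<in> W" by (rule manifold_chart_at[OF G_manifold(1) 1])
  have \<iota>1: "\<iota> \<one>\<^bsub>G\<^esub> = \<one>\<^bsub>GC\<^esub>" by (rule hom_one[OF \<iota>_hom G.is_group GC.is_group])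
  \<comment> \<open>The point is kept as \<open>- 0\<close> to match the inner reversal of time in
    the chain rule.\<close>
  obtain A where A: "((\<psi> \<circ> exp_curve G Y) has_derivative A) (at (- 0))"
    using smooth_curve_differentiable[OF exp_curve_smooth[OF Y] W(1), of 0] W(2)
    unfolding exp_curve_zero[OF Y] differentiable_def by auto
  have "((\<lambda>t::real. - t) has_derivative (\<lambda>t. - t)) (at 0)"
    by (auto intro!: derivative_eq_intros)
  from diff_chain_at[OF this A]
  have A': "((\<psi> \<circ> (\<lambda>t. exp_curve G Y (- t))) has_derivative A \<circ> (\<lambda>t. - t)) (at 0)"
    by (simp add: o_def)
  have "smooth_on (\<psi> ` {x \<in> W. \<iota> x \<in> U}) (\<phi> \<circ> \<iota> \<circ> inv_into W \<psi>)"
    using \<iota>_smooth U(1) W(1) unfolding manifold_map_def by blast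
  then have "(\<phi> \<circ> \<iota> \<circ> inv_into W \<psi>) differentiable (at (\<psi> \<one>\<^bsub>G\<^esub>))"
    by (rule smooth_on_imp_differentiable) (use W(2) U(2) \<iota>1 in auto)
  then obtain E where E: "((\<phi> \<circ> \<iota>) \<circ> inv_into W \<psi> has_derivative E) (at (\<psi> (exp_curve G Y (- 0))))"
    unfolding differentiable_def by (auto simp: exp_curve_zero[OF Y])
  have "((\<phi> \<circ> \<iota>) \<circ> (\<lambda>t. exp_curve G Y (- t)) has_derivative E \<circ> (A \<circ> (\<lambda>t. - t))) (at 0)"
    by (rule has_derivative_along_curve[OF G_manifold(1) exp_curve_reverse_continuous[OF Y] W(1) _ A' E])
      (simp add: W(2) exp_curve_zero[OF Y])
  then have "(\<phi> \<circ> translation Y) differentiable (at 0)"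
    unfolding differentiable_def by (auto simp: o_def translation_def[abs_def])
  then show thesis using that by (simp only: vector_derivative_works)
qed

text \<open>The denominator still belongs to the untranslated \<open>g\<close>. The formula
  therefore holds for every t, including times at which the translated point has left the
  domain.\<close>

lemma cinner_coherent_state_translate:
  assumes Y: "Y \<in> lie_algebra G" and g: "g \<in> \<Union> V"
  shows "cinner (coherent_state G T e0 X (z (g <#\<^bsub>GC\<^esub> B))) (T (exp_curve G Y t) \<psi>) =
    rep_fun \<psi> (translation Y t \<otimes>\<^bsub>GC\<^esub> g) / rep_fun e0 g"
proof -
  let ?a = "exp_curve G Y (- t)" and ?k = "1 / cinner e0 (TC (\<sigma> g) e0)"
  let ?E = "coherent_state G T e0 X (z (g <#\<^bsub>GC\<^esub> B))"
  have a: "?a \<in> carrier G" and b: "exp_curve G Y t \<in> carrier G" by (rule exp_curve_carrier[OF Y])+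
  have gC: "g \<in> carrier GC" by (rule Union_V_carrier[OF g])
  have un: "cinner (T ?a v) (T ?a w) = cinner v w" "T ?a (c *\<^sub>C v) = c *\<^sub>C T ?a v" for v w c
    using unitary a by (simp_all add: unitary_rep_def clinear_on_def)
  have "T ?a (T (exp_curve G Y t) \<psi>) = T (?a \<otimes>\<^bsub>G\<^esub> exp_curve G Y t) \<psi>"
    using unitary a b by (simp add: unitary_rep_def)
  also have "\<dots> = \<psi>" using unitary by (simp add: exp_curve_minus[OF Y] unitary_rep_def)
  finally have 1: "T ?a (T (exp_curve G Y t) \<psi>) = \<psi>" .
  have "T ?a (TC (\<sigma> g) e0) = TC (\<iota> ?a) (TC (\<sigma> g) e0)"
    using a gC e0_D by (simp add: TC_\<iota> TC_D)
  also have "\<dots> = TC (\<iota> ?a \<otimes>\<^bsub>GC\<^esub> \<sigma> g) e0"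
    using a gC e0_D by (simp add: TC_mult)
  \<comment> \<open>Conjugation fixes the image of \<open>G\<close>, so a real element passes
    through \<open>\<sigma>\<close> unchanged.\<close>
  also have "\<iota> ?a \<otimes>\<^bsub>GC\<^esub> \<sigma> g = \<sigma> (translation Y t \<otimes>\<^bsub>GC\<^esub> g)"
    using a gC by (simp add: hom_mult[OF \<sigma>_hom] \<sigma>_\<iota> translation_def)
  finally have 2: "T ?a (TC (\<sigma> g) e0) = TC (\<sigma> (translation Y t \<otimes>\<^bsub>GC\<^esub> g)) e0" .
  have "cinner ?E (T (exp_curve G Y t) \<psi>) = cinner (T ?a ?E) (T ?a (T (exp_curve G Y t) \<psi>))"
    by (rule un(1)[symmetric])
  also have "\<dots> = cinner (?k *\<^sub>C TC (\<sigma> (translation Y t \<otimes>\<^bsub>GC\<^esub> g)) e0) \<psi>"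
    unfolding 1 coherent_state_eq[OF g] un(2) 2 ..
  also have "\<dots> = rep_fun \<psi> (translation Y t \<otimes>\<^bsub>GC\<^esub> g) / rep_fun e0 g"
    by (simp add: cinner_scaleC_left rep_fun_def cinner_commute[of e0 "TC (\<sigma> g) e0"])
  finally show ?thesis .
qed

lemma translate_continuous:
  assumes Y: "Y \<in> lie_algebra G" and g: "g \<in> carrier GC"
  shows "continuous_map euclidean (topo GC) (\<lambda>t. translation Y t \<otimes>\<^bsub>GC\<^esub> g)"
proof -
  have "continuous_map euclidean (prod_topology (topo GC) (topo GC)) (\<lambda>t. (translation Y t, g))"
    using translation_continuous[OF Y] g GC_manifold(2) by (simp add: continuous_map_pairedI)
  from continuous_map_compose[OF this GC_mult_continuous] show ?thesis by (simp add: o_def)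
qed

section \<open>The induced vector field and the first order operator\<close>

text \<open>The fundamental vector field of left translation by exp(-tY). Values of \<open>z\<close>
  outside \<open>V\<close> are unspecified, but points of \<open>V\<close> stay there for small t,
  and the derivative at 0 sees nothing else.\<close>

definition vector_field :: "real ^ 'd \<Rightarrow> 'n \<Rightarrow> complex ^ 'n \<Rightarrow> complex"
  where "vector_field Y i w =
    vector_derivative (\<lambda>t. z (translation Y t <#\<^bsub>GC\<^esub> inv_into V z w) $ i) (at 0)"

lemma vector_field_eq:
  assumes "Y \<in> lie_algebra G" "g \<in> \<Union> V"
  shows "vector_field Y i (z (g <#\<^bsub>GC\<^esub> B)) =
    vector_derivative (\<lambda>t. z ((translation Y t \<otimes>\<^bsub>GC\<^esub> g) <#\<^bsub>GC\<^esub> B) $ i) (at 0)"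
proof -
  have "B \<subseteq> carrier GC" using B_carrier by blast
  then have "translation Y t <#\<^bsub>GC\<^esub> (g <#\<^bsub>GC\<^esub> B) = (translation Y t \<otimes>\<^bsub>GC\<^esub> g) <#\<^bsub>GC\<^esub> B" for t
    using translation_carrier[OF assms(1)] Union_V_carrier[OF assms(2)] by (simp add: GC.lcos_m_assoc)
  then show ?thesis
    using inv_into_f_f[OF z_inj_on coset_in_V[OF assms(2)]] by (simp add: vector_field_def)
qed

lemma vector_field:
  assumes Y: "Y \<in> lie_algebra G"
  shows vector_field_holo: "holo_on (z ` V) (vector_field Y i)"
    and vector_field_derivative: "g \<in> \<Union> V \<Longrightarrow>
      ((\<lambda>t. z ((translation Y t \<otimes>\<^bsub>GC\<^esub> g) <#\<^bsub>GC\<^esub> B) $ i) has_vector_derivative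
        vector_field Y i (z (g <#\<^bsub>GC\<^esub> B))) (at 0)"
proof -
  have 1: "\<one>\<^bsub>GC\<^esub> \<in> topspace (topo GC)" by (simp add: GC_manifold(2))
  obtain U \<phi> where U: "(U, \<phi>) \<in> atlas GC" "\<one>\<^bsub>GC\<^esub> \<in> U"
    by (rule manifold_chart_at[OF GC_manifold(1) 1])
  obtain v where v: "((\<phi> \<circ> translation Y) has_vector_derivative v) (at 0)"
    by (rule translation_differentiable[OF Y U])
  note d = left_translation_derivative[OF GC_lie Union_V_open coordinate_holo
      translation_continuous[OF Y] translation_zero[OF Y] U v]
  show "holo_on (z ` V) (vector_field Y i)"
    by (rule holo_on_coordinates[OF d(2)]) (simp add: vector_field_eq[OF Y])
  show "((\<lambda>t. z ((translation Y t \<otimes>\<^bsub>GC\<^esub> g) <#\<^bsub>GC\<^esub> B) $ i) has_vector_derivative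
      vector_field Y i (z (g <#\<^bsub>GC\<^esub> B))) (at 0)" if "g \<in> \<Union> V"
    unfolding vector_field_eq[OF Y that] vector_derivative_works[symmetric] by (rule d(1)[OF that])
qed

lemma transform_dT:
  assumes Y: "Y \<in> lie_algebra G" and \<psi>: "\<psi> \<in> smooth_vectors G T" and w: "w \<in> z ` V"
  shows "transform (dT G T Y \<psi>) w = transform (dT G T Y e0) w * transform \<psi> w +
    (\<Sum>i\<in>UNIV. vector_field Y i w * cpartial i (transform \<psi>) w)"
proof -
  obtain g where g: "g \<in> \<Union> V" and wg: "w = z (g <#\<^bsub>GC\<^esub> B)" using w V_coset by blast
  have gC: "g \<in> carrier GC" by (rule Union_V_carrier[OF g])
  define gt where "gt t = translation Y t \<otimes>\<^bsub>GC\<^esub> g" for t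
  have gt0: "gt 0 = g" using gC by (simp add: gt_def translation_zero[OF Y])
  define F where "F \<psi> t = cinner (coherent_state G T e0 X w) (T (exp_curve G Y t) \<psi>)" for \<psi> t
  have F: "(F \<psi> has_vector_derivative transform (dT G T Y \<psi>) w) (at 0)"
    if "\<psi> \<in> smooth_vectors G T" for \<psi>
    unfolding F_def cs_transform_def
    by (rule bounded_linear.has_vector_derivative[OF bounded_bilinear.bounded_linear_right[OF
      bounded_bilinear_cinner] dT_has_vector_derivative[OF Y that]])
  have Feq: "F \<psi> t = rep_fun \<psi> (gt t) / rep_fun e0 g" for \<psi> t
    unfolding F_def wg gt_def by (rule cinner_coherent_state_translate[OF Y g])
  have "openin euclidean {t \<in> topspace euclidean. gt t \<in> \<Union> V}"
    unfolding gt_def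
    by (rule openin_continuous_map_preimage[OF translate_continuous[OF Y gC] Union_V_open])
  then have op: "open {t. gt t \<in> \<Union> V}" by simp
  \<comment> \<open>Where the translated point lies in the domain, \<open>rep_fun e0 (gt t)\<close>
    cancels and \<open>R\<close> equals \<open>F \<psi>\<close>; the first factor does not contain
    \<open>\<psi>\<close>.\<close>
  define R where "R t = F e0 t * transform \<psi> (z (gt t <#\<^bsub>GC\<^esub> B))" for t
  have "((\<lambda>t. transform \<psi> (z (gt t <#\<^bsub>GC\<^esub> B))) has_vector_derivative
      (\<Sum>i\<in>UNIV. vector_field Y i w * cpartial i (transform \<psi>) (z (gt 0 <#\<^bsub>GC\<^esub> B)))) (at 0)"
    unfolding wg gt_def
    by (rule has_vector_derivative_holo_on_compose[OF transform_holo])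
      (use w vector_field_derivative[OF Y g] in \<open>simp_all add: gt0[unfolded gt_def] wg\<close>)
  \<comment> \<open>Product rule at 0, where \<open>F e0 0 = 1\<close>; the derivative of
    \<open>F e0\<close> there is the transform of \<open>dT G T Y e0\<close>.\<close>
  from has_vector_derivative_mult[OF F[OF e0_smooth] this]
  have "(R has_vector_derivative transform (dT G T Y e0) w * transform \<psi> w +
      (\<Sum>i\<in>UNIV. vector_field Y i w * cpartial i (transform \<psi>) w)) (at 0)"
    using g unfolding R_def Feq gt0 wg[symmetric] by (simp add: Union_V add.commute)
  then have "(F \<psi> has_vector_derivative transform (dT G T Y e0) w * transform \<psi> w +
      (\<Sum>i\<in>UNIV. vector_field Y i w * cpartial i (transform \<psi>) w)) (at 0)"
  proof (rule has_vector_derivative_transform_within_open[OF _ op])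
    fix t assume "t \<in> {t. gt t \<in> \<Union> V}"
    then have "gt t \<in> \<Union> V" by simp
    then show "R t = F \<psi> t"
      unfolding R_def Feq transform_eq[OF \<open>gt t \<in> \<Union> V\<close>] by (simp add: Union_V)
  qed (use g gt0 in simp)
  from vector_derivative_unique_at[OF F[OF \<psi>] this] show ?thesis .
qed

lemma transform_dTC:
  "transform (dTC G T Z \<psi>) w = transform (dT G T (vec_Re Z) \<psi>) w + \<i> * transform (dT G T (vec_Im Z) \<psi>) w"
  by (simp add: cs_transform_def dTC_def cinner_add_right cinner_scaleC_right)

text \<open>The operators for \<open>vec_Re Z\<close> and \<open>vec_Im Z\<close> combine
  complex-linearly. The zeroth order terms add up to the transform of \<open>dTC G T Z e0\<close>,
  holomorphic like every transform.\<close>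

lemma first_order_operator:
  assumes "Z \<in> lie_algebra_C G"
  shows "\<exists>P Q. holo_on (z ` V) P \<and> (\<forall>i. holo_on (z ` V) (Q i)) \<and>
    (\<forall>\<psi>\<in>smooth_vectors G T. \<forall>w\<in>z ` V. transform (dTC G T Z \<psi>) w =
       P w * transform \<psi> w + (\<Sum>i\<in>UNIV. Q i w * cpartial i (transform \<psi>) w))"
proof -
  let ?A = "vec_Re Z" and ?B = "vec_Im Z"
  have AB: "?A \<in> lie_algebra G" "?B \<in> lie_algebra G" using assms by (simp_all add: lie_algebra_C_def)
  define Q where "Q i w = vector_field ?A i w + \<i> * vector_field ?B i w" for i w
  have "holo_on (z ` V) (Q i)" for i
    using holo_on_add[OF vector_field_holo[OF AB(1)] holo_on_scaleC[OF vector_field_holo[OF AB(2)]],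
        of i \<i> i]
    by (simp add: Q_def[abs_def] scaleC_complex_def)
  moreover have "transform (dTC G T Z \<psi>) w = transform (dTC G T Z e0) w * transform \<psi> w +
      (\<Sum>i\<in>UNIV. Q i w * cpartial i (transform \<psi>) w)"
    if "\<psi> \<in> smooth_vectors G T" "w \<in> z ` V" for \<psi> w
    unfolding transform_dTC transform_dT[OF AB(1) that] transform_dT[OF AB(2) that] Q_def
    by (simp add: algebra_simps sum.distrib sum_distrib_left)
  ultimately show ?thesis
    by (intro exI[of _ "transform (dTC G T Z e0)"] exI[of _ Q]) (simp add: transform_holo)
qed

end

theorem proposition2:
  fixes G :: "('g, real ^ 'd::finite) lie_group"
    and GC :: "('k, complex ^ 'd) lie_group"
    and \<iota> :: "'g \<Rightarrow> 'k" and \<sigma> :: "'k \<Rightarrow> 'k"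
    and T :: "'g \<Rightarrow> 'h \<Rightarrow> 'h::complex_hilbert"
    and D :: "'h set" and TC :: "'k \<Rightarrow> 'h \<Rightarrow> 'h"
    and e0 :: 'h and B :: "'k set"
    and X :: "'n::finite \<Rightarrow> complex ^ 'd" and z :: "'k set \<Rightarrow> complex ^ 'n"
  defines "M \<equiv> cs_manifold G GC \<iota> B"
  defines "V0 \<equiv> cs_domain GC \<sigma> TC e0 B M"
  assumes "separable_space (euclidean :: 'h topology)"
    and "complexification G GC \<iota> \<sigma>"
    and "cs_representation TYPE('n) G T e0"
    and "holomorphic_extension G GC \<iota> T D TC" and "e0 \<in> D"
    and "cs_homogeneous_embedding G GC \<iota> \<sigma> T TC e0 B"
    and "cs_very_ample GC \<sigma> TC e0 B M"
    and "coherent_coordinates G GC \<sigma> T TC e0 B V0 X z"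
  shows "\<forall>Z\<in>lie_algebra_C G. \<exists>P Q.
    holo_on (z ` V0) P \<and> (\<forall>i. holo_on (z ` V0) (Q i)) \<and>
    (\<forall>\<psi>\<in>smooth_vectors G T. \<forall>w\<in>z ` V0.
       cs_transform G T e0 X (dTC G T Z \<psi>) w =
         P w * cs_transform G T e0 X \<psi> w +
         (\<Sum>i\<in>UNIV. Q i w * cpartial i (cs_transform G T e0 X \<psi>) w))"
proof
  fix Z assume "Z \<in> lie_algebra_C G"
  moreover have "coherent_state_setting G GC \<iota> \<sigma> T D TC e0 B X z M V0"
    using assms by unfold_locales (auto simp: cs_representation_def)
  ultimately show "\<exists>P Q. holo_on (z ` V0) P \<and> (\<forall>i. holo_on (z ` V0) (Q i)) \<and>
    (\<forall>\<psi>\<in>smooth_vectors G T. \<forall>w\<in>z ` V0.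
       cs_transform G T e0 X (dTC G T Z \<psi>) w =
         P w * cs_transform G T e0 X \<psi> w +
         (\<Sum>i\<in>UNIV. Q i w * cpartial i (cs_transform G T e0 X \<psi>) w))"
    by (intro coherent_state_setting.first_order_operator)
qed

end
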